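(* Let $g_1,\ldots,g_m\in\mathbb{R}[x]$ and let $\mathbf{K}=\{x\in\mathbb{R}^n:g_j(x)\geq0,\ j=1,\ldots,m\}$ be compact, with $\mathbf{K}\subset\mathbf{B}\subseteq[-1,1]^n$, $\mathbf{B}$ a Borel set. Assume that $0\leq g_j\leq1$ on $\mathbf{K}$ for every $j=1,\ldots,m$ and that the family $(1,g_1,\ldots,g_m)$ generates the algebra $\mathbb{R}[x]$. Let $\mu_2$ be the normalized Lebesgue measure on $\mathbf{B}$, $\mu_2(\mathbf{C})=\mathrm{vol}(\mathbf{C})/2^n$ for Borel $\mathbf{C}\subseteq\mathbf{B}$, with moment sequence $\mathbf{y}_2=(y_{2\alpha})_{\alpha\in\mathbb{N}^n}$, $y_{2\alpha}=\int x^\alpha\,d\mu_2$. For $d\in\mathbb{N}$ consider the linear program $$\mathrm{L}_d:\quad\left\{\begin{array}{ll}\displaystyle\sup_{\mathbf{y}_1}&y_{1,0}\\ \text{s.t.}&L_{\mathbf{y}_2-\mathbf{y}_1}\Big(\displaystyle\prod_{i=1}^n(1+x_i)^{\alpha_i}(1-x_i)^{\beta_i}\Big)\geq0,\qquad\alpha,\beta\in\mathbb{N}^n_d\\[2mm] &L_{\mathbf{y}_1}\big(g^\alpha(1-g)^\beta\big)\geq0,\qquad\alpha,\beta\in\mathbb{N}^m_d,\end{array}\right.$$ where the unknown is the finite real vector $\mathbf{y}_1=(y_{1\alpha})$ indexed by all $\alpha\in\mathbb{N}^n$ with $|\alpha|\leq 2d\max_j\deg g_j$ (so that all constraints make sense)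 and $y_{1,0}$ is its entry for $\alpha=0$. Then: (a) $\mathrm{L}_d$ has an optimal solution (so its optimal value is a maximum, denoted $\max\mathrm{L}_d$), and $\max\mathrm{L}_d\downarrow\mathrm{vol}(\mathbf{K})/2^n$ as $d\to\infty$ (monotone non-increasing convergence). (b) If, for each $d$, $\mathbf{y}_1^d=(y^d_{1\alpha})$ is an optimal solution of $\mathrm{L}_d$, then $$\lim_{d\to\infty}y^d_{1\alpha}=\int_{\mathbf{K}}x^\alpha\,d\mu_2\qquad\text{for every }\alpha\in\mathbb{N}^n.$$
   Context: $\mathbb{R}[x]$ is the ring of real polynomials in $x=(x_1,\ldots,x_n)$. For $k\in\{n,m\}$ and $\alpha\in\mathbb{N}^k$, $|\alpha|=\sum_i\alpha_i$ and $\mathbb{N}^k_d=\{\alpha\in\mathbb{N}^k:|\alpha|\leq d\}$. For $\alpha,\beta\in\mathbb{N}^m$, $g^\alpha=g_1^{\alpha_1}\cdots g_m^{\alpha_m}$ and $(1-g)^\beta=(1-g_1)^{\beta_1}\cdots(1-g_m)^{\beta_m}$. For a real family $\mathbf{y}=(y_\alpha)$ indexed by exponents in $\mathbb{N}^n$, $L_{\mathbf{y}}$ is the linear functional $L_{\mathbf{y}}(\sum_\alpha f_\alpha x^\alpha)=\sum_\alpha f_\alpha y_\alpha$; in $\mathbf{y}_2-\mathbf{y}_1$, $\mathbf{y}_2$ is truncated to the index set of $\mathbf{y}_1$. *)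

theory Defs
  imports "HOL-Analysis.Analysis" "HOL-Library.Poly_Mapping" "HOL-Library.FuncSet"
begin

text \<open>
  Real polynomials in finitely many variables, indexed by \<open>'n\<close>, are the finitely supported
  functions from exponents \<open>'n \<Rightarrow>\<^sub>0 nat\<close> to coefficients; \<open>HOL-Library.Poly_Mapping\<close> provides
  the convolution product and hence the ring structure.
\<close>

type_synonym 'n rpoly = "('n \<Rightarrow>\<^sub>0 nat) \<Rightarrow>\<^sub>0 real"

definition Const :: "real \<Rightarrow> 'n rpoly" where
  "Const c = Poly_Mapping.single 0 c"

definition Var :: "'n \<Rightarrow> 'n rpoly" where
  "Var i = Poly_Mapping.single (Poly_Mapping.single i 1) 1"

definition expo_deg :: "('k::finite \<Rightarrow>\<^sub>0 nat) \<Rightarrow> nat" where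
  "expo_deg \<alpha> = (\<Sum>i\<in>UNIV. Poly_Mapping.lookup \<alpha> i)"

text \<open>The zero polynomial is given total degree 0.\<close>

definition total_degree :: "('n::finite) rpoly \<Rightarrow> nat" where
  "total_degree p = Max (insert 0 (expo_deg ` Poly_Mapping.keys p))"

definition mpower :: "('k::finite \<Rightarrow> 'a::comm_monoid_mult) \<Rightarrow> ('k \<Rightarrow>\<^sub>0 nat) \<Rightarrow> 'a" where
  "mpower u \<alpha> = (\<Prod>i\<in>UNIV. u i ^ Poly_Mapping.lookup \<alpha> i)"

definition poly_eval :: "('n::finite) rpoly \<Rightarrow> real ^ 'n \<Rightarrow> real" where
  "poly_eval p x = (\<Sum>\<alpha>\<in>Poly_Mapping.keys p. Poly_Mapping.lookup p \<alpha> * mpower (\<lambda>i. x $ i) \<alpha>)"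

definition subalgebra :: "'n rpoly set \<Rightarrow> bool" where
  "subalgebra A \<longleftrightarrow> 0 \<in> A \<and> (\<forall>p\<in>A. \<forall>q\<in>A. p + q \<in> A) \<and>
     (\<forall>c. \<forall>p\<in>A. Const c * p \<in> A) \<and> (\<forall>p\<in>A. \<forall>q\<in>A. p * q \<in> A)"

definition semialg_set :: "('m \<Rightarrow> ('n::finite) rpoly) \<Rightarrow> (real ^ 'n) set" where
  "semialg_set g = {x. \<forall>j. poly_eval (g j) x \<ge> 0}"

definition normalized_lebesgue :: "(real ^ 'n::finite) set \<Rightarrow> (real ^ 'n) measure" where
  "normalized_lebesgue B = scale_measure (ennreal (1 / 2 ^ CARD('n))) (restrict_space lborel B)"

definition moments :: "(real ^ 'n::finite) measure \<Rightarrow> ('n \<Rightarrow>\<^sub>0 nat) \<Rightarrow> real" where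
  "moments M \<alpha> = (\<integral>x. mpower (\<lambda>i. x $ i) \<alpha> \<partial>M)"

text \<open>The functional \<open>L\<^sub>y\<close> only looks at \<open>y\<close> on the support of the polynomial.\<close>

definition riesz :: "(('n \<Rightarrow>\<^sub>0 nat) \<Rightarrow> real) \<Rightarrow> 'n rpoly \<Rightarrow> real" where
  "riesz y p = (\<Sum>\<alpha>\<in>Poly_Mapping.keys p. Poly_Mapping.lookup p \<alpha> * y \<alpha>)"

definition lp_index :: "('m::finite \<Rightarrow> ('n::finite) rpoly) \<Rightarrow> nat \<Rightarrow> ('n \<Rightarrow>\<^sub>0 nat) set" where
  "lp_index g d = {\<alpha>. expo_deg \<alpha> \<le> 2 * d * Max (range (\<lambda>j. total_degree (g j)))}"

text \<open>
  The unknown, a vector indexed by the finite set \<open>lp_index g d\<close>, is a function that is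
  \<^const>\<open>undefined\<close> outside this set, so that distinct functions are distinct vectors.
  If the \<open>g j\<close> generate the polynomial ring, they are not all constant, so every monomial
  occurring in a constraint has its exponent in \<open>lp_index g d\<close>.
\<close>

definition lp_feasible ::
  "('m::finite \<Rightarrow> ('n::finite) rpoly) \<Rightarrow> (real ^ 'n) set \<Rightarrow> nat \<Rightarrow> (('n \<Rightarrow>\<^sub>0 nat) \<Rightarrow> real) set" where
  "lp_feasible g B d = {y \<in> lp_index g d \<rightarrow>\<^sub>E UNIV.
     (\<forall>\<alpha> \<beta> :: 'n \<Rightarrow>\<^sub>0 nat. expo_deg \<alpha> \<le> d \<and> expo_deg \<beta> \<le> d \<longrightarrow>
        riesz (\<lambda>\<gamma>\<in>lp_index g d. moments (normalized_lebesgue B) \<gamma> - y \<gamma>)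
          (\<Prod>i\<in>UNIV. (1 + Var i) ^ Poly_Mapping.lookup \<alpha> i * (1 - Var i) ^ Poly_Mapping.lookup \<beta> i) \<ge> 0) \<and>
     (\<forall>\<alpha> \<beta> :: 'm \<Rightarrow>\<^sub>0 nat. expo_deg \<alpha> \<le> d \<and> expo_deg \<beta> \<le> d \<longrightarrow>
        riesz y (mpower g \<alpha> * mpower (\<lambda>j. 1 - g j) \<beta>) \<ge> 0)}"

definition lp_optimal ::
  "('m::finite \<Rightarrow> ('n::finite) rpoly) \<Rightarrow> (real ^ 'n) set \<Rightarrow> nat \<Rightarrow> (('n \<Rightarrow>\<^sub>0 nat) \<Rightarrow> real) \<Rightarrow> bool" where
  "lp_optimal g B d y \<longleftrightarrow> y \<in> lp_feasible g B d \<and> (\<forall>z\<in>lp_feasible g B d. z 0 \<le> y 0)"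

text \<open>A supremum of reals, meaningful only when the program is feasible and bounded.\<close>

definition lp_value :: "('m::finite \<Rightarrow> ('n::finite) rpoly) \<Rightarrow> (real ^ 'n) set \<Rightarrow> nat \<Rightarrow> real" where
  "lp_value g B d = (SUP y\<in>lp_feasible g B d. y 0)"

end

theory Submission
  imports Defs
begin

text \<open>
  The theorem rests on finite certificates of positivity. Let \<open>0 \<le> g\<^sub>j \<le> 1\<close> on \<open>K\<close> and let the
  \<open>g\<^sub>j\<close> generate the polynomial ring. If \<open>f\<close> is strictly positive on
  \<open>K = {x. \<forall>j. g\<^sub>j(x) \<ge> 0}\<close>, then \<open>f\<close> is a nonnegative combination of
  finitely many products \<open>g\<^sup>\<alpha> (1 - g)\<^sup>\<beta>\<close> (lemma \<open>krivine_positivstellensatz\<close>).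
  Only finitely many exponents occur, so from some \<open>d\<close> on, every feasible \<open>y\<close>
  satisfies \<open>L\<^sub>y(f) \<ge> 0\<close>. The same statement for the cube, described by the functions
  \<open>(1 + x\<^sub>i) / 2\<close>, gives \<open>L\<^sub>y(f) \<le> \<integral> f d\<mu>\<^sub>2\<close> for large \<open>d\<close> whenever
  \<open>f > 0\<close> on the cube. Since these inequalities hold for all large \<open>d\<close> at once,
  the limit is obtained without extracting subsequences and without representing limit functionals
  by measures.

  To use them, let \<open>q > 0\<close> on the cube and let \<open>f\<close> be a polynomial that lies slightly
  above a continuous nonnegative function which is \<open>1\<close> on \<open>K\<close> and whose integral is close to
  the measure of \<open>K\<close>. Then \<open>f q - q > 0\<close> on \<open>K\<close> and \<open>f q > 0\<close> on the cube, hence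
  \<open>L\<^sub>y(q) \<le> L\<^sub>y(f q) \<le> \<integral> f q d\<mu>\<^sub>2\<close>, and the right side is as close to
  \<open>\<integral>\<^sub>K q d\<mu>\<^sub>2\<close> as desired (lemma \<open>feasible_asymptotic_upper_bound\<close>).
  For \<open>q = 1\<close> this is the upper bound on the optimal value; the lower bound holds because the
  moments of the restriction of \<open>\<mu>\<^sub>2\<close> to \<open>K\<close> are feasible. For \<open>q = 2 \<plusminus> x\<^sup>\<alpha>\<close>
  it then yields both bounds on \<open>y\<^sub>\<alpha>\<close>.

  An optimal solution exists for every \<open>d\<close> because a feasible linear program with bounded
  objective attains its maximum (lemma \<open>linear_program_attains_max\<close>). The feasible set itself need
  not be compact: for small \<open>d\<close> the constraints may leave some entries of the vector unbounded.
\<close>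

section \<open>Polynomials as linear combinations of monomials\<close>

lemma rpoly_induct [case_names monomial add]:
  fixes p :: "'k rpoly"
  assumes "\<And>\<alpha> c. Q (Poly_Mapping.single \<alpha> c)" and "\<And>p q. Q p \<Longrightarrow> Q q \<Longrightarrow> Q (p + q)"
  shows "Q p"
proof (induction p rule: Poly_Mapping.update_induct)
  case const
  show ?case using assms(1)[of 0 0] by simp
next
  case (update f a b)
  have "Poly_Mapping.update a b f = f + Poly_Mapping.single a b"
    using update(1)
    by (intro poly_mapping_eqI) (auto simp: lookup_update lookup_add lookup_single in_keys_iff when_def)
  with update assms show ?case by auto
qed

text \<open>
  Evaluation at a point, substitution of polynomials for the variables, and the Riesz functional are
  all instances of one construction: extend a function \<open>y\<close> on the exponents linearly, with the
  scalars mapped by \<open>c\<close>. The ring laws are therefore proved only once.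
\<close>

definition linear_extension ::
    "(real \<Rightarrow> 'b::comm_ring_1) \<Rightarrow> (('k \<Rightarrow>\<^sub>0 nat) \<Rightarrow> 'b) \<Rightarrow> 'k rpoly \<Rightarrow> 'b" where
  "linear_extension c y p =
     (\<Sum>\<alpha>\<in>Poly_Mapping.keys p. c (Poly_Mapping.lookup p \<alpha>) * y \<alpha>)"

locale scalar_hom =
  fixes c :: "real \<Rightarrow> 'b::comm_ring_1"
  assumes c_zero: "c 0 = 0" and c_one: "c 1 = 1"
    and c_add: "c (a + b) = c a + c b" and c_mult: "c (a * b) = c a * c b"
begin

lemma ext_single: "linear_extension c y (Poly_Mapping.single \<alpha> a) = c a * y \<alpha>"
  by (simp add: linear_extension_def c_zero)

lemma ext_zero: "linear_extension c y 0 = 0"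
  by (simp add: linear_extension_def)

lemma ext_add: "linear_extension c y (p + q) = linear_extension c y p + linear_extension c y q"
  unfolding linear_extension_def
  by (rule setsum_keys_plus_distrib[where f="\<lambda>k a. c a * y k"])
     (simp_all add: c_zero c_add distrib_right)

lemma ext_sum: "linear_extension c y (sum f A) = (\<Sum>a\<in>A. linear_extension c y (f a))"
  by (induction A rule: infinite_finite_induct) (simp_all add: ext_zero ext_add)

lemma ext_diff: "linear_extension c y (p - q) = linear_extension c y p - linear_extension c y q"
  using ext_add[of y "p - q" q] by simp

lemma ext_one: "y 0 = 1 \<Longrightarrow> linear_extension c y 1 = 1"
  using ext_single[of y 0 1] by (simp add: c_one)

lemma ext_Const: "y 0 = 1 \<Longrightarrow> linear_extension c y (Const a) = c a"
  by (simp add: Const_def ext_single)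

lemma ext_mult:
  assumes "\<And>\<alpha> \<beta>. y (\<alpha> + \<beta>) = y \<alpha> * y \<beta>"
  shows "linear_extension c y (p * q) = linear_extension c y p * linear_extension c y q"
proof (induction p rule: rpoly_induct)
  case (monomial \<alpha> a)
  show ?case
  proof (induction q rule: rpoly_induct)
    case (monomial \<beta> b)
    show ?case by (simp add: mult_single ext_single c_mult assms)
  qed (simp add: ext_add distrib_left)
qed (simp add: ext_add distrib_right)

lemma ext_Const_mult: "linear_extension c y (Const a * p) = c a * linear_extension c y p"
proof (induction p rule: rpoly_induct)
  case (monomial \<alpha> b)
  show ?case by (simp add: Const_def mult_single ext_single c_mult)
qed (simp add: ext_add distrib_left)

end

interpretation real_scalar: scalar_hom "\<lambda>a::real. a"
  by unfold_locales simp_all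

lemma Const_zero: "Const 0 = 0" by (simp add: Const_def)

lemma Const_one: "Const 1 = 1" by (simp add: Const_def)

lemma Const_add: "Const (a + b) = Const a + Const b" by (simp add: Const_def single_add)

lemma Const_mult: "Const (a * b) = Const a * Const b" by (simp add: Const_def mult_single)

lemma Const_of_nat: "Const (of_nat k) = of_nat k"
  by (induction k) (simp_all add: Const_zero Const_add Const_one)

lemma Const_power: "Const (a ^ k) = Const a ^ k"
  by (induction k) (simp_all add: Const_one Const_mult)

lemma Const_prod: "Const (prod f A) = (\<Prod>a\<in>A. Const (f a))"
  by (induction A rule: infinite_finite_induct) (simp_all add: Const_one Const_mult)

interpretation Const_scalar: scalar_hom Const
  by unfold_locales (simp_all add: Const_zero Const_one Const_add Const_mult)

lemma mpower_zero [simp]: "mpower u 0 = 1" by (simp add: mpower_def)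

lemma mpower_add: "mpower u (\<alpha> + \<beta>) = mpower u \<alpha> * mpower u \<beta>"
  by (simp add: mpower_def lookup_add power_add prod.distrib)

lemma mpower_single: "mpower u (Poly_Mapping.single i k) = u i ^ k"
proof -
  have "mpower u (Poly_Mapping.single i k) = (\<Prod>j\<in>UNIV. if j = i then u i ^ k else 1)"
    unfolding mpower_def by (rule prod.cong) (auto simp: lookup_single when_def)
  thus ?thesis by simp
qed

lemma mpower_mult: "mpower (\<lambda>i. u i * v i) \<alpha> = mpower u \<alpha> * mpower v \<alpha>"
  by (simp add: mpower_def power_mult_distrib prod.distrib)

lemma mpower_nonneg: "(\<And>i. 0 \<le> u i) \<Longrightarrow> 0 \<le> mpower u \<alpha>" for u :: "'k::finite \<Rightarrow> real"
  unfolding mpower_def by (rule prod_nonneg) simp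

lemma exists_exponent: "\<exists>\<alpha> :: 'k::finite \<Rightarrow>\<^sub>0 nat. Poly_Mapping.lookup \<alpha> = k"
  by (rule exI[of _ "Abs_poly_mapping k"]) simp

definition subst :: "('m::finite \<Rightarrow> 'n rpoly) \<Rightarrow> 'm rpoly \<Rightarrow> 'n rpoly" where
  "subst g = linear_extension Const (mpower g)"

lemma poly_eval_ext: "poly_eval p x = linear_extension (\<lambda>a. a) (mpower (\<lambda>i. x $ i)) p"
  by (simp add: poly_eval_def linear_extension_def)

lemma riesz_ext: "riesz y p = linear_extension (\<lambda>a. a) y p"
  by (simp add: riesz_def linear_extension_def)

lemma poly_eval_zero [simp]: "poly_eval 0 x = 0"
  and poly_eval_one [simp]: "poly_eval 1 x = 1"
  and poly_eval_Const [simp]: "poly_eval (Const a) x = a"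
  and poly_eval_Var [simp]: "poly_eval (Var i) x = x $ i"
  and poly_eval_add [simp]: "poly_eval (p + q) x = poly_eval p x + poly_eval q x"
  and poly_eval_diff [simp]: "poly_eval (p - q) x = poly_eval p x - poly_eval q x"
  and poly_eval_mult [simp]: "poly_eval (p * q) x = poly_eval p x * poly_eval q x"
  and poly_eval_sum [simp]: "poly_eval (sum f A) x = (\<Sum>a\<in>A. poly_eval (f a) x)"
  by (simp_all add: poly_eval_ext real_scalar.ext_zero real_scalar.ext_one real_scalar.ext_Const
      real_scalar.ext_add real_scalar.ext_diff real_scalar.ext_mult mpower_add real_scalar.ext_sum
      Var_def real_scalar.ext_single mpower_single)

lemma poly_eval_prod [simp]: "poly_eval (prod f A) x = (\<Prod>a\<in>A. poly_eval (f a) x)"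
  by (induction A rule: infinite_finite_induct) simp_all

lemma poly_eval_power [simp]: "poly_eval (p ^ k) x = poly_eval p x ^ k"
  by (induction k) simp_all

lemma poly_eval_mpower [simp]: "poly_eval (mpower u \<alpha>) x = mpower (\<lambda>j. poly_eval (u j) x) \<alpha>"
  by (simp add: mpower_def)

lemma poly_eval_monomial [simp]: "poly_eval (Poly_Mapping.single \<alpha> 1) x = mpower (\<lambda>i. x $ i) \<alpha>"
  by (simp add: poly_eval_ext real_scalar.ext_single)

lemma continuous_on_poly_eval [continuous_intros]: "continuous_on S (poly_eval p)"
  unfolding poly_eval_def mpower_def by (intro continuous_intros)

lemma subst_zero [simp]: "subst g 0 = 0"
  and subst_one [simp]: "subst g 1 = 1"
  and subst_Const [simp]: "subst g (Const a) = Const a"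
  and subst_Var [simp]: "subst g (Var j) = g j"
  and subst_add [simp]: "subst g (p + q) = subst g p + subst g q"
  and subst_diff [simp]: "subst g (p - q) = subst g p - subst g q"
  and subst_mult [simp]: "subst g (p * q) = subst g p * subst g q"
  and subst_sum [simp]: "subst g (sum f A) = (\<Sum>a\<in>A. subst g (f a))"
  by (simp_all add: subst_def Const_scalar.ext_zero Const_scalar.ext_one Const_scalar.ext_Const
      Const_scalar.ext_add Const_scalar.ext_diff Const_scalar.ext_mult mpower_add Const_scalar.ext_sum
      Var_def Const_scalar.ext_single mpower_single Const_one)

lemma subst_prod [simp]: "subst g (prod f A) = (\<Prod>a\<in>A. subst g (f a))"
  by (induction A rule: infinite_finite_induct) simp_all

lemma subst_power [simp]: "subst g (p ^ k) = subst g p ^ k"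
  by (induction k) simp_all

lemma subst_mpower [simp]: "subst g (mpower u \<alpha>) = mpower (\<lambda>j. subst g (u j)) \<alpha>"
  by (simp add: mpower_def)

lemma subst_single: "subst g (Poly_Mapping.single \<alpha> a) = Const a * mpower g \<alpha>"
  by (simp add: subst_def Const_scalar.ext_single)

lemma poly_eval_subst: "poly_eval (subst g p) x = poly_eval p (\<chi> j. poly_eval (g j) x)"
proof (induction p rule: rpoly_induct)
  case (monomial \<alpha> a)
  show ?case by (simp add: subst_single) (simp add: poly_eval_ext real_scalar.ext_single)
qed simp

lemma subst_subst: "subst g (subst h p) = subst (\<lambda>i. subst g (h i)) p"
proof (induction p rule: rpoly_induct)
  case (monomial \<alpha> a)
  show ?case by (simp add: subst_single)
qed simp

lemma mpower_Var: "mpower Var \<alpha> = Poly_Mapping.single (\<alpha> :: 'k::finite \<Rightarrow>\<^sub>0 nat) 1"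
proof -
  have *: "Var i ^ k = Poly_Mapping.single (Poly_Mapping.single i k) 1" for i :: 'k and k
    by (induction k) (simp_all add: Var_def mult_single single_add[symmetric])
  have "mpower Var \<alpha> =
      (\<Prod>i\<in>UNIV. Poly_Mapping.single (Poly_Mapping.single i (Poly_Mapping.lookup \<alpha> i)) 1)"
    by (simp add: mpower_def *)
  also have "\<dots> =
      Poly_Mapping.single (\<Sum>i\<in>UNIV. Poly_Mapping.single i (Poly_Mapping.lookup \<alpha> i)) 1"
  proof -
    have "finite A \<Longrightarrow> (\<Prod>i\<in>A. Poly_Mapping.single (f i) 1) =
        (Poly_Mapping.single (\<Sum>i\<in>A. f i) 1 :: 'k rpoly)" for A :: "'k set" and f
      by (induction A rule: finite_induct) (simp_all add: mult_single)
    thus ?thesis by simp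
  qed
  also have "(\<Sum>i\<in>UNIV. Poly_Mapping.single i (Poly_Mapping.lookup \<alpha> i)) = \<alpha>"
    by (rule poly_mapping_eqI) (simp add: lookup_sum lookup_single when_def)
  finally show ?thesis .
qed

lemma subst_identity: "subst Var p = p"
proof (induction p rule: rpoly_induct)
  case (monomial \<alpha> a)
  show ?case by (simp add: subst_single mpower_Var Const_def mult_single)
qed simp

lemma riesz_add: "riesz y (p + q) = riesz y p + riesz y q"
  and riesz_diff: "riesz y (p - q) = riesz y p - riesz y q"
  and riesz_zero [simp]: "riesz y 0 = 0"
  and riesz_Const_mult: "riesz y (Const a * p) = a * riesz y p"
  by (simp_all only: riesz_ext real_scalar.ext_add real_scalar.ext_diff real_scalar.ext_zero
      real_scalar.ext_Const_mult)

lemma riesz_single: "riesz y (Poly_Mapping.single \<alpha> a) = a * y \<alpha>"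
  by (simp add: riesz_ext real_scalar.ext_single)

lemma riesz_one: "riesz y 1 = y 0"
  using riesz_single[of y 0 1] by simp

lemma riesz_Const: "riesz y (Const a) = a * y 0"
  by (simp add: Const_def riesz_single)

text \<open>
  That \<open>g\<close> generates the polynomial ring means that every variable is a polynomial in
  \<open>g\<close>; this is the only form in which the hypothesis on generation enters the proof.
\<close>

lemma generating_imp_variables:
  fixes g :: "'m::finite \<Rightarrow> 'n rpoly"
  assumes "subalgebra hull (insert 1 (range g)) = UNIV"
  obtains X :: "'n \<Rightarrow> 'm rpoly" where "\<And>i. subst g (X i) = Var i"
proof -
  have "subalgebra (range (subst g))"
    unfolding subalgebra_def
  proof (intro conjI ballI allI)
    show "0 \<in> range (subst g)" by (metis subst_zero rangeI)
  next
    fix p q assume "p \<in> range (subst g)" "q \<in> range (subst g)"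
    then obtain P Q where "p = subst g P" "q = subst g Q" by auto
    then show "p + q \<in> range (subst g)" "p * q \<in> range (subst g)"
      by (metis subst_add rangeI, metis subst_mult rangeI)
  next
    fix c p assume "p \<in> range (subst g)"
    then obtain P where "p = subst g P" by auto
    then show "Const c * p \<in> range (subst g)"
      by (metis subst_mult subst_Const rangeI)
  qed
  moreover have "insert 1 (range g) \<subseteq> range (subst g)"
    by (metis insert_subset image_subsetI rangeI subst_one subst_Var)
  ultimately have "subalgebra hull (insert 1 (range g)) \<subseteq> range (subst g)"
    by (rule hull_minimal[rotated])
  with assms have "\<forall>i. \<exists>P. subst g P = Var i" by (metis UNIV_I rangeE subsetD)
  with that show ?thesis by metis
qed

section \<open>Certificates of positivity\<close>

text \<open>
  The binomial coefficient \<open>k choose r\<close> replaces the power \<open>(k / N)\<^sup>r\<close> of the usual Bernstein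
  polynomials: with it the expansion of \<open>t\<^sup>r\<close> is exact, by
  \<open>(N choose k) (k choose r) = (N choose r) ((N - r) choose (k - r))\<close> and the binomial theorem for
  \<open>(t + (1 - t))\<^sup>N\<^sup>-\<^sup>r = 1\<close>. Being an identity of polynomials, it can be used in any ring.
\<close>

lemma bernstein_power_expansion:
  fixes t :: "'a::comm_ring_1"
  assumes "r \<le> N"
  shows "(\<Sum>k\<le>N. of_nat ((N choose k) * (k choose r)) * (t ^ k * (1 - t) ^ (N - k))) =
    of_nat (N choose r) * t ^ r"
proof -
  have "(\<Sum>k\<le>N. of_nat ((N choose k) * (k choose r)) * (t ^ k * (1 - t) ^ (N - k))) =
      (\<Sum>k\<in>{r..N}. of_nat ((N choose k) * (k choose r)) * (t ^ k * (1 - t) ^ (N - k)))"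
    by (rule sum.mono_neutral_right) (auto simp: binomial_eq_0 not_le)
  also have "\<dots> = (\<Sum>l\<in>{..N - r}. of_nat ((N choose (l + r)) * ((l + r) choose r)) *
      (t ^ (l + r) * (1 - t) ^ (N - (l + r))))"
    by (rule sum.reindex_bij_witness[of _ "\<lambda>l. l + r" "\<lambda>k. k - r"]) (use assms in auto)
  also have "\<dots> = (\<Sum>l\<in>{..N - r}. of_nat (N choose r) * t ^ r *
      (of_nat ((N - r) choose l) * t ^ l * (1 - t) ^ (N - r - l)))"
  proof (rule sum.cong[OF refl])
    fix l assume "l \<in> {..N - r}"
    then have "l + r \<le> N" using assms by auto
    then have "(N choose (l + r)) * ((l + r) choose r) = (N choose r) * ((N - r) choose l)"
      by (subst choose_mult) auto
    then show "of_nat ((N choose (l + r)) * ((l + r) choose r)) *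
        (t ^ (l + r) * (1 - t) ^ (N - (l + r))) = of_nat (N choose r) * t ^ r *
      (of_nat ((N - r) choose l) * t ^ l * (1 - t) ^ (N - r - l))"
      by (simp add: power_add algebra_simps)
  qed
  also have "\<dots> = of_nat (N choose r) * t ^ r * (t + (1 - t)) ^ (N - r)"
    by (simp only: binomial_ring sum_distrib_left)
  finally show ?thesis by simp
qed

text \<open>
  The Bernstein coefficient of \<open>t\<^sup>r\<close> at \<open>k\<close>, in degree \<open>N\<close>. It converges to the value
  \<open>(k / N)\<^sup>r\<close> as \<open>N\<close> grows, uniformly in \<open>k\<close>.
\<close>

definition choose_ratio :: "nat \<Rightarrow> nat \<Rightarrow> nat \<Rightarrow> real" where
  "choose_ratio N k r = real (k choose r) / real (N choose r)"

abbreviation ratio_product :: "nat \<Rightarrow> ('m::finite \<Rightarrow> nat) \<Rightarrow> ('m \<Rightarrow>\<^sub>0 nat) \<Rightarrow> real" where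
  "ratio_product N k \<gamma> \<equiv> \<Prod>j\<in>UNIV. choose_ratio N (k j) (Poly_Mapping.lookup \<gamma> j)"

lemma choose_ratio_prod: "choose_ratio N k r = (\<Prod>i<r. (real k - real i) / (real N - real i))"
  unfolding choose_ratio_def binomial_gbinomial gbinomial_prod_rev
  by (simp add: prod_dividef lessThan_atLeast0)

text \<open>
  The ratio and the power are both products of \<open>r\<close> factors in \<open>[-1, 1]\<close>, so their
  difference is at most the sum of the absolute differences of the factors. The hypothesis \<open>2 * r < N\<close> keeps the factors
  \<open>(k - i) / (N - i)\<close> in this range even when \<open>k < i\<close>.
\<close>

lemma choose_ratio_error:
  assumes "k \<le> N" and "2 * r < N"
  shows "\<bar>choose_ratio N k r - (real k / real N) ^ r\<bar> \<le> real r ^ 2 / (real N - real r)"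
proof -
  have "\<bar>choose_ratio N k r - (real k / real N) ^ r\<bar> =
      norm ((\<Prod>i<r. (real k - real i) / (real N - real i)) - (\<Prod>i<r. real k / real N))"
    by (simp add: choose_ratio_prod)
  also have "\<dots> \<le> (\<Sum>i<r. norm ((real k - real i) / (real N - real i) - real k / real N))"
  proof (rule norm_prod_diff)
    fix i assume "i \<in> {..<r}"
    then have "i < r" by simp
    have "\<bar>real k - real i\<bar> \<le> real N - real i" "real N - real i > 0"
      using assms \<open>i < r\<close> by linarith+
    then show "norm ((real k - real i) / (real N - real i)) \<le> 1"
      by (simp add: abs_divide divide_le_eq)
  qed (use assms in simp)
  also have "\<dots> \<le> (\<Sum>i<r. real r / (real N - real r))"
  proof (rule sum_mono)
    fix i assume "i \<in> {..<r}"
    then have i: "i < r" by simp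
    have pos: "real N > 0" "real N - real i > 0" "real N - real r > 0" "real i \<le> real r"
      using assms i by linarith+
    have "(real k - real i) / (real N - real i) - real k / real N =
        - ((real i / (real N - real i)) * ((real N - real k) / real N))"
      using pos by (simp add: field_simps)
    then have "norm ((real k - real i) / (real N - real i) - real k / real N) =
        (real i / (real N - real i)) * ((real N - real k) / real N)"
      using pos assms by (simp add: abs_mult abs_divide)
    also have "\<dots> \<le> (real i / (real N - real i)) * 1"
      using pos assms by (intro mult_left_mono) (auto simp: divide_le_eq)
    also have "\<dots> \<le> real r / (real N - real r)"
      using pos by (simp add: frac_le)
    finally show "norm ((real k - real i) / (real N - real i) - real k / real N) \<le>
        real r / (real N - real r)" .
  qed
  also have "\<dots> = real r ^ 2 / (real N - real r)"
    by (simp add: power2_eq_square)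
  finally show ?thesis .
qed

lemma choose_ratio_uniform_limit:
  assumes "e > 0"
  shows "\<forall>\<^sub>F N in sequentially.
    r \<le> N \<and> (\<forall>k\<le>N. \<bar>choose_ratio N k r - (real k / real N) ^ r\<bar> \<le> e)"
  using eventually_ge_at_top[of "2 * r + 1 + nat \<lceil>real r ^ 2 / e\<rceil>"]
proof eventually_elim
  case (elim N)
  have "real N \<ge> 2 * real r + 1 + real r ^ 2 / e"
    using elim real_nat_ceiling_ge[of "real r ^ 2 / e"] by linarith
  then have "real r ^ 2 / e \<le> real N - real r" "real N - real r > 0"
    using assms by (smt (verit) of_nat_0_le_iff)
      (smt (verit) \<open>real N \<ge> _\<close> assms divide_nonneg_pos of_nat_0_le_iff zero_le_power2)
  then have "real r ^ 2 / (real N - real r) \<le> e"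
    using assms by (simp add: divide_le_eq mult.commute)
  moreover have "2 * r < N" using elim by linarith
  ultimately show ?case
    using choose_ratio_error[of _ N r] by (auto intro: order_trans)
qed

abbreviation krivine_product ::
    "('m::finite \<Rightarrow> 'n rpoly) \<Rightarrow> ('m \<Rightarrow>\<^sub>0 nat) \<Rightarrow> ('m \<Rightarrow>\<^sub>0 nat) \<Rightarrow> 'n rpoly" where
  "krivine_product g \<alpha> \<beta> \<equiv> mpower g \<alpha> * mpower (\<lambda>j. 1 - g j) \<beta>"

text \<open>
  The convex cone generated by the products \<open>g\<^sup>\<alpha> (1 - g)\<^sup>\<beta>\<close>. Membership is a finite
  certificate: it involves finitely many pairs of exponents only.
\<close>

inductive_set krivine_cone :: "('m::finite \<Rightarrow> 'n rpoly) \<Rightarrow> 'n rpoly set"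
  for g :: "'m \<Rightarrow> 'n rpoly" where
  zero: "0 \<in> krivine_cone g"
| add: "p \<in> krivine_cone g \<Longrightarrow> 0 \<le> c \<Longrightarrow>
    Const c * (krivine_product g \<alpha> \<beta>) + p \<in> krivine_cone g"

lemma krivine_cone_sum:
  fixes g :: "'m::finite \<Rightarrow> 'n rpoly"
  assumes "\<And>a. a \<in> A \<Longrightarrow> 0 \<le> c a"
  shows "(\<Sum>a\<in>A. Const (c a) * (\<Prod>j\<in>UNIV. g j ^ u a j * (1 - g j) ^ v a j)) \<in> krivine_cone g"
  using assms
proof (induction A rule: infinite_finite_induct)
  case (insert a A)
  obtain \<alpha> \<beta> :: "'m \<Rightarrow>\<^sub>0 nat"
    where *: "Poly_Mapping.lookup \<alpha> = u a" "Poly_Mapping.lookup \<beta> = v a"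
    using exists_exponent by metis
  have "(\<Prod>j\<in>UNIV. g j ^ u a j * (1 - g j) ^ v a j) = krivine_product g \<alpha> \<beta>"
    by (simp add: mpower_def * prod.distrib)
  with insert show ?case by (simp add: krivine_cone.add)
qed (simp_all add: krivine_cone.zero)

text \<open>
  The Bernstein expansion of a polynomial in several variables, transported to the elements
  \<open>g j\<close> of another polynomial ring. Multiplying the one-variable expansions of the factors of a
  monomial gives the coefficients as products of ratios.
\<close>

lemma bernstein_subst:
  fixes g :: "'m::finite \<Rightarrow> 'n rpoly"
  assumes "\<And>\<gamma> j. \<gamma> \<in> Poly_Mapping.keys P \<Longrightarrow> Poly_Mapping.lookup \<gamma> j \<le> N"
  shows "subst g P = (\<Sum>k\<in>PiE UNIV (\<lambda>_. {..N}).
      Const ((\<Sum>\<gamma>\<in>Poly_Mapping.keys P. Poly_Mapping.lookup P \<gamma> *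
                ratio_product N k \<gamma>) *
             (\<Prod>j\<in>UNIV. real (N choose k j))) *
      (\<Prod>j\<in>UNIV. g j ^ k j * (1 - g j) ^ (N - k j)))"
    (is "_ = (\<Sum>k\<in>?K. Const (?w k * ?b k) * ?h k)")
proof -
  have power: "t ^ r =
      (\<Sum>k\<le>N. Const (choose_ratio N k r * real (N choose k)) * (t ^ k * (1 - t) ^ (N - k)))"
    if "r \<le> N" for t :: "'n rpoly" and r
  proof -
    have nz: "real (N choose r) \<noteq> 0" using that by simp
    have "Const (1 / real (N choose r)) * (of_nat (N choose r) * t ^ r) =
        (\<Sum>k\<le>N. Const (1 / real (N choose r)) *
          (Const (real ((N choose k) * (k choose r))) * (t ^ k * (1 - t) ^ (N - k))))"
      unfolding Const_of_nat
      by (simp only: bernstein_power_expansion[OF that, symmetric] sum_distrib_left)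
    moreover have "Const (1 / real (N choose r)) * (of_nat (N choose r) * t ^ r) = t ^ r"
      unfolding Const_of_nat[symmetric] mult.assoc[symmetric] Const_mult[symmetric]
      using nz by (simp add: Const_one)
    moreover have "Const (1 / real (N choose r)) *
          (Const (real ((N choose k) * (k choose r))) * (t ^ k * (1 - t) ^ (N - k))) =
        Const (choose_ratio N k r * real (N choose k)) * (t ^ k * (1 - t) ^ (N - k))" for k
      unfolding mult.assoc[symmetric] Const_mult[symmetric]
      by (simp add: choose_ratio_def mult.commute)
    ultimately show ?thesis by simp
  qed
  have monom: "mpower g \<gamma> =
      (\<Sum>k\<in>?K. Const (ratio_product N k \<gamma> * ?b k) * ?h k)"
    if "\<gamma> \<in> Poly_Mapping.keys P" for \<gamma>
  proof -
    have "mpower g \<gamma> = (\<Prod>j\<in>UNIV. \<Sum>k\<le>N.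
        Const (choose_ratio N k (Poly_Mapping.lookup \<gamma> j) * real (N choose k)) *
        (g j ^ k * (1 - g j) ^ (N - k)))"
      unfolding mpower_def by (rule prod.cong[OF refl], rule power[OF assms[OF that]])
    also have "\<dots> = (\<Sum>k\<in>?K. \<Prod>j\<in>UNIV.
        Const (choose_ratio N (k j) (Poly_Mapping.lookup \<gamma> j) * real (N choose k j)) *
        (g j ^ k j * (1 - g j) ^ (N - k j)))"
      by (rule prod_sum_PiE) auto
    finally show ?thesis
      by (simp add: prod.distrib Const_prod Const_mult)
  qed
  have "subst g P = (\<Sum>\<gamma>\<in>Poly_Mapping.keys P. Const (Poly_Mapping.lookup P \<gamma>) * mpower g \<gamma>)"
    by (simp add: subst_def linear_extension_def)
  also have "\<dots> = (\<Sum>\<gamma>\<in>Poly_Mapping.keys P. \<Sum>k\<in>?K. Const (Poly_Mapping.lookup P \<gamma> *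
      ratio_product N k \<gamma> * ?b k) * ?h k)"
    by (rule sum.cong[OF refl]) (simp add: monom sum_distrib_left Const_mult mult.assoc)
  also have "\<dots> = (\<Sum>k\<in>?K. \<Sum>\<gamma>\<in>Poly_Mapping.keys P. Const (Poly_Mapping.lookup P \<gamma> *
      ratio_product N k \<gamma> * ?b k) * ?h k)"
    by (rule sum.swap)
  also have "\<dots> = (\<Sum>k\<in>?K. Const (?w k * ?b k) * ?h k)"
  proof (rule sum.cong[OF refl])
    fix k
    have "Const (sum f A) = (\<Sum>a\<in>A. Const (f a) :: 'n rpoly)" for f :: "('m \<Rightarrow>\<^sub>0 nat) \<Rightarrow> real" and A
      by (induction A rule: infinite_finite_induct) (simp_all add: Const_zero Const_add)
    then show "(\<Sum>\<gamma>\<in>Poly_Mapping.keys P. Const (Poly_Mapping.lookup P \<gamma> *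
      ratio_product N k \<gamma> * ?b k) * ?h k) = Const (?w k * ?b k) * ?h k"
      by (simp add: sum_distrib_right)
  qed
  finally show ?thesis .
qed

definition unit_cube :: "(real ^ 'm) set" where
  "unit_cube = {z. \<forall>j. 0 \<le> z $ j \<and> z $ j \<le> 1}"

lemma compact_unit_cube: "compact (unit_cube :: (real ^ 'm::finite) set)"
proof -
  have "unit_cube = (cbox (\<chi> j. 0) (\<chi> j. 1) :: (real ^ 'm) set)"
    by (auto simp: unit_cube_def mem_box_cart)
  then show ?thesis by (metis compact_cbox)
qed

text \<open>
  Bernstein's theorem: for large \<open>N\<close> the coefficient at \<open>k\<close> is within the minimum \<open>\<delta>\<close> of
  \<open>P\<close> of the value of \<open>P\<close> at the grid point \<open>k / N\<close>, so it is positive.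
\<close>

lemma positive_on_cube_subst:
  fixes g :: "'m::finite \<Rightarrow> 'n rpoly" and P :: "'m rpoly"
  assumes pos: "\<And>z. z \<in> unit_cube \<Longrightarrow> poly_eval P z > 0"
  shows "subst g P \<in> krivine_cone g"
proof -
  have "(0 :: real ^ 'm) \<in> unit_cube" by (simp add: unit_cube_def)
  then obtain z0 :: "real ^ 'm" where z0: "z0 \<in> unit_cube"
      "\<And>z. z \<in> unit_cube \<Longrightarrow> poly_eval P z0 \<le> poly_eval P z"
    using continuous_attains_inf[OF compact_unit_cube _ continuous_on_poly_eval] by (metis empty_iff)
  define \<delta> where "\<delta> = poly_eval P z0"
  have \<delta>: "\<delta> > 0" "\<And>z. z \<in> unit_cube \<Longrightarrow> \<delta> \<le> poly_eval P z" using z0 pos by (auto simp: \<delta>_def)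
  \<comment> \<open>An error of \<open>\<delta> / C\<close> in each one-variable ratio makes the error of a coefficient smaller than \<open>\<delta>\<close>.\<close>
  define C where "C = 1 + (\<Sum>\<gamma>\<in>Poly_Mapping.keys P. \<bar>Poly_Mapping.lookup P \<gamma>\<bar> * real CARD('m))"
  have C: "C > 0" unfolding C_def by (intro add_pos_nonneg sum_nonneg) auto
  define e where "e = \<delta> / C"
  have e: "e > 0" using \<delta> C by (simp add: e_def)
  have "\<forall>\<^sub>F N in sequentially. \<forall>\<gamma>\<in>Poly_Mapping.keys P. \<forall>j\<in>UNIV.
      Poly_Mapping.lookup \<gamma> j \<le> N \<and>
      (\<forall>k\<le>N. \<bar>choose_ratio N k (Poly_Mapping.lookup \<gamma> j) -
        (real k / real N) ^ Poly_Mapping.lookup \<gamma> j\<bar> \<le> e)"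
    by (intro eventually_ball_finite ballI choose_ratio_uniform_limit e) auto
  then obtain N where N: "\<And>\<gamma> j. \<gamma> \<in> Poly_Mapping.keys P \<Longrightarrow> Poly_Mapping.lookup \<gamma> j \<le> N"
      "\<And>\<gamma> j k. \<gamma> \<in> Poly_Mapping.keys P \<Longrightarrow> k \<le> N \<Longrightarrow>
        \<bar>choose_ratio N k (Poly_Mapping.lookup \<gamma> j) - (real k / real N) ^ Poly_Mapping.lookup \<gamma> j\<bar> \<le> e"
    using eventually_happens'[OF sequentially_bot] by (metis (no_types, lifting) UNIV_I)
  show ?thesis
  proof (subst bernstein_subst[where N=N], use N in blast, rule krivine_cone_sum)
    fix k :: "'m \<Rightarrow> nat" assume "k \<in> PiE UNIV (\<lambda>_. {..N})"
    then have k: "\<And>j. k j \<le> N" by auto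
    define z :: "real ^ 'm" where "z = (\<chi> j. real (k j) / real N)"
    have "z \<in> unit_cube" using k by (auto simp: unit_cube_def z_def divide_le_eq_1)
    then have "\<delta> \<le> poly_eval P z" by (rule \<delta>)
    define w where "w = (\<Sum>\<gamma>\<in>Poly_Mapping.keys P. Poly_Mapping.lookup P \<gamma> *
                ratio_product N k \<gamma>)"
    have ratio_le: "choose_ratio N (k j) r \<le> 1" "0 \<le> choose_ratio N (k j) r" if "r \<le> N" for j r
      using k[of j] that by (auto simp: choose_ratio_def divide_le_eq_1 intro: binomial_right_mono)
    have "\<bar>w - poly_eval P z\<bar> = \<bar>\<Sum>\<gamma>\<in>Poly_Mapping.keys P. Poly_Mapping.lookup P \<gamma> *
        (ratio_product N k \<gamma> - mpower (\<lambda>j. real (k j) / real N) \<gamma>)\<bar>"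
      by (simp add: w_def poly_eval_def mpower_def z_def sum_subtractf right_diff_distrib)
    also have "\<dots> \<le> (\<Sum>\<gamma>\<in>Poly_Mapping.keys P. \<bar>Poly_Mapping.lookup P \<gamma>\<bar> * (real CARD('m) * e))"
    proof (rule order_trans[OF sum_abs], rule sum_mono, simp only: abs_mult, rule mult_left_mono)
      fix \<gamma> assume \<gamma>: "\<gamma> \<in> Poly_Mapping.keys P"
      have "norm (ratio_product N k \<gamma> - mpower (\<lambda>j. real (k j) / real N) \<gamma>)
        \<le> (\<Sum>j\<in>UNIV. norm (choose_ratio N (k j) (Poly_Mapping.lookup \<gamma> j) -
            (real (k j) / real N) ^ Poly_Mapping.lookup \<gamma> j))"
        unfolding mpower_def using ratio_le N(1)[OF \<gamma>] k
        by (intro norm_prod_diff) (auto intro!: power_le_one simp: divide_le_eq_1)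
      also have "\<dots> \<le> (\<Sum>j\<in>(UNIV :: 'm set). e)"
        using N(2)[OF \<gamma> k] by (intro sum_mono) auto
      finally show "\<bar>ratio_product N k \<gamma> - mpower (\<lambda>j. real (k j) / real N) \<gamma>\<bar>
        \<le> real CARD('m) * e" by simp
    qed simp
    also have "\<dots> = (C - 1) * e" by (simp add: C_def sum_distrib_right mult.assoc)
    also have "\<dots> < \<delta>" using e C by (simp add: e_def field_simps)
    finally have "w > 0" using \<open>\<delta> \<le> poly_eval P z\<close> by linarith
    then show "0 \<le> (\<Sum>\<gamma>\<in>Poly_Mapping.keys P. Poly_Mapping.lookup P \<gamma> *
                ratio_product N k \<gamma>) * (\<Prod>j\<in>UNIV. real (N choose k j))"
      unfolding w_def[symmetric] by (intro mult_nonneg_nonneg prod_nonneg) auto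
  qed
qed

text \<open>
  The point is to pass from positivity on \<open>{x. 0 \<le> g\<^sub>j(x) \<le> 1}\<close> to positivity on the whole unit
  cube of the variables \<open>z\<^sub>j\<close>, which stand for the \<open>g\<^sub>j\<close>. The map \<open>x \<mapsto> g(x)\<close> has the polynomial
  left inverse \<open>X\<close>. The polynomial \<open>Q(z) = \<Sum>\<^sub>j (z\<^sub>j - g\<^sub>j(X(z)))\<^sup>2\<close> is nonnegative, vanishes
  only on the image of this map, and becomes \<open>0\<close> when \<open>g\<close> is substituted for \<open>z\<close>. Since
  \<open>P(z) = f(X(z))\<close> is positive where \<open>Q\<close> vanishes on the cube, \<open>P + N Q\<close> is positive on the
  cube for large \<open>N\<close> by compactness, and it still becomes \<open>f\<close> after the substitution.
\<close>

lemma krivine_positivstellensatz: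
  fixes g :: "'m::finite \<Rightarrow> ('n::finite) rpoly"
  assumes X: "\<And>i. subst g (X i) = Var i"
    and pos: "\<And>x. (\<And>j. 0 \<le> poly_eval (g j) x \<and> poly_eval (g j) x \<le> 1) \<Longrightarrow> poly_eval f x > 0"
  shows "f \<in> krivine_cone g"
proof -
  define P where "P = subst X f"
  define Q where "Q = (\<Sum>j\<in>UNIV. (Var j - subst X (g j)) ^ 2)"
  have retract: "subst g (subst X p) = p" for p
    by (simp add: subst_subst X subst_identity)
  have subst_Q: "subst g Q = 0" by (simp add: Q_def retract)
  have Q_nonneg: "poly_eval Q z \<ge> 0" for z by (simp add: Q_def sum_nonneg)
  have P_pos: "poly_eval P z > 0" if "z \<in> unit_cube" "poly_eval Q z = 0" for z
  proof -
    define x where "x = (\<chi> i. poly_eval (X i) z)"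
    have "(\<Sum>j\<in>UNIV. (z $ j - poly_eval (g j) x) ^ 2) = 0"
      using that(2) by (simp add: Q_def poly_eval_subst x_def)
    then have "\<forall>j. z $ j = poly_eval (g j) x" by (simp add: sum_nonneg_eq_0_iff)
    with that(1) have "poly_eval f x > 0" by (intro pos) (auto simp: unit_cube_def)
    then show ?thesis by (simp add: P_def poly_eval_subst x_def)
  qed
  \<comment> \<open>Where \<open>P \<le> 0\<close>, the polynomial \<open>Q\<close> is bounded below by a positive constant.\<close>
  have "\<exists>N. \<forall>z\<in>unit_cube. poly_eval P z + N * poly_eval Q z > 0"
  proof -
    let ?A = "{z \<in> unit_cube. poly_eval P z \<le> 0}"
    have "compact (unit_cube \<inter> {z. poly_eval P z \<le> 0})"
      by (intro compact_Int_closed compact_unit_cube closed_Collect_le continuous_on_poly_eval) simp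
    then have compA: "compact ?A" by (simp add: Int_def)
    show ?thesis
    proof (cases "?A = {}")
      case True
      then show ?thesis by (intro exI[of _ 0]) force
    next
      case False
      obtain zq where zq: "zq \<in> ?A" "\<And>z. z \<in> ?A \<Longrightarrow> poly_eval Q zq \<le> poly_eval Q z"
        using continuous_attains_inf[OF compA False continuous_on_poly_eval[of _ Q]] by blast
      obtain zp where zp: "zp \<in> ?A" "\<And>z. z \<in> ?A \<Longrightarrow> poly_eval P zp \<le> poly_eval P z"
        using continuous_attains_inf[OF compA False continuous_on_poly_eval[of _ P]] by blast
      have m: "poly_eval Q zq > 0" using zq(1) P_pos[of zq] Q_nonneg[of zq] by fastforce
      define N where "N = (1 - poly_eval P zp) / poly_eval Q zq"
      have N: "N \<ge> 0" "N * poly_eval Q zq = 1 - poly_eval P zp"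
        using m zp(1) by (auto simp: N_def)
      have "poly_eval P z + N * poly_eval Q z > 0" if "z \<in> unit_cube" for z
      proof (cases "poly_eval P z \<le> 0")
        case True
        then have "z \<in> ?A" using that by simp
        then have "N * poly_eval Q zq \<le> N * poly_eval Q z" "poly_eval P zp \<le> poly_eval P z"
          using mult_left_mono[OF zq(2) N(1)] zp(2) by blast+
        then show ?thesis using N by linarith
      next
        case False
        then show ?thesis using N Q_nonneg[of z] by (simp add: add_pos_nonneg)
      qed
      then show ?thesis by blast
    qed
  qed
  then obtain N where N: "\<And>z. z \<in> unit_cube \<Longrightarrow> poly_eval P z + N * poly_eval Q z > 0" by blast
  have "subst g (P + Const N * Q) \<in> krivine_cone g"
    by (rule positive_on_cube_subst) (simp add: N)
  then show ?thesis by (simp add: subst_Q P_def retract)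
qed

section \<open>Attainment in linear programs\<close>

lemma between_finite_sets:
  fixes L U :: "real set"
  assumes "finite L" "finite U" "\<And>l u. l \<in> L \<Longrightarrow> u \<in> U \<Longrightarrow> l \<le> u"
  shows "\<exists>v. (\<forall>l\<in>L. l \<le> v) \<and> (\<forall>u\<in>U. v \<le> u)"
proof (cases "L = {}")
  case True
  with assms(2) show ?thesis by (intro exI[of _ "if U = {} then 0 else Min U"]) auto
next
  case False
  with assms show ?thesis by (intro exI[of _ "Max L"]) auto
qed

text \<open>
  Fourier--Motzkin elimination: one variable is removed by requiring every lower bound on it to
  lie below every upper bound. What remains is a finite intersection of closed half-lines.
\<close>

lemma closed_projection_of_polyhedron:
  fixes C :: "(('i \<Rightarrow> real) \<times> real \<times> real) set"
  assumes "finite I" and "finite C"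
  shows "closed {t. \<exists>y. \<forall>(a, s, b)\<in>C. (\<Sum>i\<in>I. a i * y i) + s * t \<le> b}"
  using assms
proof (induction I arbitrary: C rule: finite_induct)
  case empty
  have "{t. \<exists>y::'i \<Rightarrow> real. \<forall>(a, s, b)\<in>C. (\<Sum>i\<in>{}. a i * y i) + s * t \<le> b} =
      (\<Inter>(a, s, b)\<in>C. {t. s * t \<le> b})"
    by auto
  also have "closed \<dots>"
    by (auto intro!: closed_INT closed_Collect_le continuous_intros)
  finally show ?case .
next
  case (insert i I)
  \<comment> \<open>The sum of an upper and a lower bound on the eliminated variable, scaled so that it cancels.\<close>
  define comb where "comb = (\<lambda>((a, s, b), (a', s', b')).
    (\<lambda>j. a j / a i - a' j / a' i, s / a i - s' / a' i, b / a i - b' / a' i) ::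
      ('i \<Rightarrow> real) \<times> real \<times> real)"
  define P where "P = {c \<in> C. fst c i > 0}"
  define N where "N = {c \<in> C. fst c i < 0}"
  define C' where "C' = {c \<in> C. fst c i = 0} \<union> comb ` (P \<times> N)"
  have fin: "finite P" "finite N" "finite C'"
    using insert.prems by (auto simp: P_def N_def C'_def)
  have "(\<exists>y. \<forall>(a, s, b)\<in>C. (\<Sum>i\<in>insert i I. a i * y i) + s * t \<le> b) \<longleftrightarrow>
        (\<exists>y. \<forall>(a, s, b)\<in>C'. (\<Sum>i\<in>I. a i * y i) + s * t \<le> b)" for t
  proof
    assume "\<exists>y. \<forall>(a, s, b)\<in>C. (\<Sum>i\<in>insert i I. a i * y i) + s * t \<le> b"
    then obtain y where "\<forall>(a, s, b)\<in>C. (\<Sum>i\<in>insert i I. a i * y i) + s * t \<le> b" by blast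
    then have y: "a i * y i + (\<Sum>i\<in>I. a i * y i) + s * t \<le> b" if "(a, s, b) \<in> C" for a s b
      using that insert.hyps by fastforce
    have "(\<Sum>i\<in>I. a i * y i) + s * t \<le> b" if c: "(a, s, b) \<in> C'" for a s b
    proof (cases "(a, s, b) \<in> C \<and> a i = 0")
      case True
      then show ?thesis using y[of a s b] by auto
    next
      case False
      then obtain a1 s1 b1 a2 s2 b2 where 1: "(a1, s1, b1) \<in> C" "a1 i > 0"
        and 2: "(a2, s2, b2) \<in> C" "a2 i < 0" and eq: "(a, s, b) = comb ((a1, s1, b1), (a2, s2, b2))"
        using c by (auto simp: C'_def P_def N_def)
      have up: "y i + (\<Sum>i\<in>I. a1 i * y i) / a1 i + s1 / a1 i * t \<le> b1 / a1 i"
        using divide_right_mono[OF y[OF 1(1)], of "a1 i"] 1(2) by (simp add: add_divide_distrib)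
      have low: "y i + (\<Sum>i\<in>I. a2 i * y i) / a2 i + s2 / a2 i * t \<ge> b2 / a2 i"
        using divide_right_mono_neg[OF y[OF 2(1)], of "a2 i"] 2(2) by (simp add: add_divide_distrib)
      have "(\<Sum>j\<in>I. (a1 j / a1 i - a2 j / a2 i) * y j) =
          (\<Sum>i\<in>I. a1 i * y i) / a1 i - (\<Sum>i\<in>I. a2 i * y i) / a2 i"
        by (simp add: left_diff_distrib sum_subtractf sum_divide_distrib)
      then show ?thesis using up low eq by (simp add: comb_def left_diff_distrib)
    qed
    then show "\<exists>y. \<forall>(a, s, b)\<in>C'. (\<Sum>i\<in>I. a i * y i) + s * t \<le> b" by blast
  next
    assume "\<exists>y. \<forall>(a, s, b)\<in>C'. (\<Sum>i\<in>I. a i * y i) + s * t \<le> b"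
    then obtain y where y: "\<And>a s b. (a, s, b) \<in> C' \<Longrightarrow> (\<Sum>i\<in>I. a i * y i) + s * t \<le> b" by blast
    \<comment> \<open>The bound on the value of variable \<open>i\<close> that a constraint imposes, given the other values.\<close>
    define bd where "bd = (\<lambda>(a, s, b). (b - s * t - (\<Sum>i\<in>I. a i * y i)) / a i)"
    have bd: "bd c2 \<le> bd c1" if "c1 \<in> P" "c2 \<in> N" for c1 c2
    proof -
      obtain a1 s1 b1 a2 s2 b2 where c: "c1 = (a1, s1, b1)" "c2 = (a2, s2, b2)"
        by (cases c1, cases c2) auto
      have "comb (c1, c2) \<in> C'" using that by (auto simp: C'_def)
      then have "(\<Sum>j\<in>I. (a1 j / a1 i - a2 j / a2 i) * y j) + (s1 / a1 i - s2 / a2 i) * t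
          \<le> b1 / a1 i - b2 / a2 i"
        unfolding c comb_def by (intro y) simp
      moreover have "(\<Sum>j\<in>I. (a1 j / a1 i - a2 j / a2 i) * y j) =
          (\<Sum>i\<in>I. a1 i * y i) / a1 i - (\<Sum>i\<in>I. a2 i * y i) / a2 i"
        by (simp add: left_diff_distrib sum_subtractf sum_divide_distrib)
      ultimately show ?thesis
        unfolding c bd_def by (simp add: diff_divide_distrib left_diff_distrib)
    qed
    have "\<exists>v. (\<forall>l\<in>bd ` N. l \<le> v) \<and> (\<forall>u\<in>bd ` P. v \<le> u)"
      by (rule between_finite_sets) (use fin bd in auto)
    then obtain v where v: "\<And>c. c \<in> N \<Longrightarrow> bd c \<le> v" "\<And>c. c \<in> P \<Longrightarrow> v \<le> bd c"
      by auto
    have "(\<Sum>j\<in>insert i I. a j * (y(i := v)) j) + s * t \<le> b" if c: "(a, s, b) \<in> C" for a s b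
    proof -
      have "(\<Sum>j\<in>I. a j * (y(i := v)) j) = (\<Sum>j\<in>I. a j * y j)"
        using insert.hyps by (intro sum.cong) auto
      then have *: "(\<Sum>j\<in>insert i I. a j * (y(i := v)) j) = a i * v + (\<Sum>j\<in>I. a j * y j)"
        using insert.hyps by simp
      consider "a i = 0" | "a i > 0" | "a i < 0" by linarith
      then show ?thesis
      proof cases
        case 1
        with c have "(a, s, b) \<in> C'" by (simp add: C'_def)
        from y[OF this] 1 * show ?thesis by simp
      next
        case 2
        with c v(2)[of "(a, s, b)"] have "v \<le> bd (a, s, b)" by (simp add: P_def)
        with 2 have "a i * v \<le> b - s * t - (\<Sum>i\<in>I. a i * y i)"
          by (simp add: bd_def pos_le_divide_eq mult.commute)
        with * show ?thesis by simp
      next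
        case 3
        with c v(1)[of "(a, s, b)"] have "bd (a, s, b) \<le> v" by (simp add: N_def)
        with 3 have "a i * v \<le> b - s * t - (\<Sum>i\<in>I. a i * y i)"
          by (simp add: bd_def neg_divide_le_eq mult.commute)
        with * show ?thesis by simp
      qed
    qed
    then show "\<exists>y. \<forall>(a, s, b)\<in>C. (\<Sum>i\<in>insert i I. a i * y i) + s * t \<le> b"
      by (intro exI[of _ "y(i := v)"]) auto
  qed
  with insert.IH[OF fin(3)] show ?case by simp
qed

text \<open>
  The set of values of the objective is a projection of a polyhedron, hence closed, so it contains
  its supremum.
\<close>

lemma linear_program_attains_max:
  fixes C :: "(('i \<Rightarrow> real) \<times> real) set"
  assumes "finite I" "finite C" "k \<in> I"
    and feasible: "\<And>a b. (a, b) \<in> C \<Longrightarrow> (\<Sum>i\<in>I. a i * w i) \<le> b"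
    and bounded: "\<And>y. (\<And>a b. (a, b) \<in> C \<Longrightarrow> (\<Sum>i\<in>I. a i * y i) \<le> b) \<Longrightarrow> y k \<le> M"
  obtains y where "\<And>a b. (a, b) \<in> C \<Longrightarrow> (\<Sum>i\<in>I. a i * y i) \<le> b"
    and "\<And>z. (\<And>a b. (a, b) \<in> C \<Longrightarrow> (\<Sum>i\<in>I. a i * z i) \<le> b) \<Longrightarrow> z k \<le> y k"
proof -
  define F where "F = {y. \<forall>(a, b)\<in>C. (\<Sum>i\<in>I. a i * y i) \<le> b}"
  \<comment> \<open>The parameter \<open>t\<close> of the projection is tied to the objective by \<open>y k \<le> t\<close> and \<open>t \<le> y k\<close>.\<close>
  define D where "D = insert (\<lambda>i. if i = k then 1 else 0, - 1 :: real, 0)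
    (insert (\<lambda>i. if i = k then - 1 else 0, 1, 0) ((\<lambda>(a, b). (a, 0 :: real, b)) ` C))"
  have D: "(\<forall>(a, s, b)\<in>D. (\<Sum>i\<in>I. a i * y i) + s * t \<le> b) \<longleftrightarrow> y \<in> F \<and> y k = t" for y t
  proof -
    have "(\<Sum>i\<in>I. (if i = k then 1 else 0) * y i) = y k"
      "(\<Sum>i\<in>I. (if i = k then - 1 else 0) * y i) = - y k"
      using assms(1,3) by (simp_all add: if_distrib[of "\<lambda>c. c * y _"] cong: if_cong)
    then show ?thesis by (auto simp: D_def F_def)
  qed
  have "finite D" using assms by (simp add: D_def)
  from closed_projection_of_polyhedron[OF assms(1) this]
  have cl: "closed ((\<lambda>y. y k) ` F)" unfolding D by (simp add: image_def eq_commute Bex_def)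
  have "w \<in> F" using feasible by (auto simp: F_def)
  moreover have bdd: "bdd_above ((\<lambda>y. y k) ` F)"
    using bounded by (intro bdd_aboveI[of _ M]) (auto simp: F_def)
  ultimately have "Sup ((\<lambda>y. y k) ` F) \<in> (\<lambda>y. y k) ` F"
    using cl by (intro closed_contains_Sup) auto
  then obtain y where y: "y \<in> F" "y k = Sup ((\<lambda>y. y k) ` F)" by auto
  show ?thesis
  proof (rule that[of y])
    fix z assume "\<And>a b. (a, b) \<in> C \<Longrightarrow> (\<Sum>i\<in>I. a i * z i) \<le> b"
    then have "z \<in> F" by (auto simp: F_def)
    then show "z k \<le> y k" unfolding y(2) using bdd by (intro cSup_upper) auto
  qed (use y in \<open>auto simp: F_def\<close>)
qed

section \<open>Degrees of the constraint polynomials\<close>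

definition degree_le :: "nat \<Rightarrow> ('k::finite) rpoly \<Rightarrow> bool" where
  "degree_le D p \<longleftrightarrow> (\<forall>\<alpha>\<in>Poly_Mapping.keys p. expo_deg \<alpha> \<le> D)"

lemma expo_deg_zero [simp]: "expo_deg 0 = 0"
  by (simp add: expo_deg_def)

lemma expo_deg_add: "expo_deg (\<alpha> + \<beta>) = expo_deg \<alpha> + expo_deg \<beta>"
  by (simp add: expo_deg_def lookup_add sum.distrib)

lemma expo_deg_single [simp]: "expo_deg (Poly_Mapping.single i k) = k"
proof -
  have "expo_deg (Poly_Mapping.single i k) = (\<Sum>j\<in>UNIV. if j = i then k else 0)"
    unfolding expo_deg_def by (rule sum.cong) (auto simp: lookup_single when_def)
  then show ?thesis by simp
qed

lemma degree_le_mono: "degree_le D p \<Longrightarrow> D \<le> E \<Longrightarrow> degree_le E p"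
  by (auto simp: degree_le_def)

lemma degree_le_add: "degree_le D p \<Longrightarrow> degree_le D q \<Longrightarrow> degree_le D (p + q)"
  using Poly_Mapping.keys_add[of p q] by (auto simp: degree_le_def)

lemma degree_le_diff: "degree_le D p \<Longrightarrow> degree_le D q \<Longrightarrow> degree_le D (p - q)"
  using keys_diff[of p q] by (auto simp: degree_le_def)

lemma degree_le_one: "degree_le D 1"
  by (simp add: degree_le_def)

lemma degree_le_mult: "degree_le D p \<Longrightarrow> degree_le E q \<Longrightarrow> degree_le (D + E) (p * q)"
  unfolding degree_le_def
proof
  fix \<gamma> assume D: "\<forall>\<alpha>\<in>Poly_Mapping.keys p. expo_deg \<alpha> \<le> D"
    and E: "\<forall>\<alpha>\<in>Poly_Mapping.keys q. expo_deg \<alpha> \<le> E" and "\<gamma> \<in> Poly_Mapping.keys (p * q)"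
  then obtain \<alpha> \<beta> where "\<gamma> = \<alpha> + \<beta>" "\<alpha> \<in> Poly_Mapping.keys p" "\<beta> \<in> Poly_Mapping.keys q"
    using keys_mult[of p q] by blast
  with D E show "expo_deg \<gamma> \<le> D + E" by (simp add: expo_deg_add add_mono)
qed

lemma degree_le_power: "degree_le D p \<Longrightarrow> degree_le (k * D) (p ^ k)"
  by (induction k) (auto simp: degree_le_one intro: degree_le_mult)

lemma degree_le_mpower:
  assumes "\<And>j. degree_le D (u j)"
  shows "degree_le (expo_deg \<alpha> * D) (mpower u \<alpha>)"
proof -
  have "finite A \<Longrightarrow> degree_le (\<Sum>i\<in>A. Poly_Mapping.lookup \<alpha> i * D)
      (\<Prod>i\<in>A. u i ^ Poly_Mapping.lookup \<alpha> i)" for A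
    by (induction A rule: finite_induct)
       (auto simp: degree_le_one intro!: degree_le_mult degree_le_power assms)
  from this[of UNIV] show ?thesis
    by (simp add: mpower_def expo_deg_def sum_distrib_right)
qed

lemma degree_le_mpower_mult:
  assumes "\<And>j. degree_le D (u j)" "\<And>j. degree_le D (v j)" "expo_deg \<alpha> \<le> d" "expo_deg \<beta> \<le> d"
  shows "degree_le (2 * d * D) (mpower u \<alpha> * mpower v \<beta>)"
proof (rule degree_le_mono)
  show "degree_le (expo_deg \<alpha> * D + expo_deg \<beta> * D) (mpower u \<alpha> * mpower v \<beta>)"
    by (intro degree_le_mult degree_le_mpower assms(1,2))
  have "expo_deg \<alpha> * D + expo_deg \<beta> * D \<le> d * D + d * D"
    using assms(3,4) by (intro add_mono mult_right_mono) auto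
  then show "expo_deg \<alpha> * D + expo_deg \<beta> * D \<le> 2 * d * D" by simp
qed

lemma degree_le_total_degree: "degree_le (total_degree p) p"
  by (simp add: degree_le_def total_degree_def)

lemma finite_expo_deg_le: "finite {\<alpha> :: 'k::finite \<Rightarrow>\<^sub>0 nat. expo_deg \<alpha> \<le> d}"
proof (rule inj_on_finite)
  show "inj_on Poly_Mapping.lookup {\<alpha> :: 'k \<Rightarrow>\<^sub>0 nat. expo_deg \<alpha> \<le> d}"
    by (simp add: inj_on_def)
  show "Poly_Mapping.lookup ` {\<alpha> :: 'k \<Rightarrow>\<^sub>0 nat. expo_deg \<alpha> \<le> d} \<subseteq> PiE UNIV (\<lambda>_. {..d})"
  proof (intro image_subsetI PiE_I)
    fix \<alpha> :: "'k \<Rightarrow>\<^sub>0 nat" and i :: 'k assume "\<alpha> \<in> {\<alpha>. expo_deg \<alpha> \<le> d}"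
    moreover have "Poly_Mapping.lookup \<alpha> i \<le> expo_deg \<alpha>"
      unfolding expo_deg_def by (rule member_le_sum) auto
    ultimately show "Poly_Mapping.lookup \<alpha> i \<in> {..d}" by simp
  qed auto
  show "finite (PiE (UNIV :: 'k set) (\<lambda>_. {..d}))" by (intro finite_PiE) auto
qed

abbreviation box_product ::
    "(('n::finite) \<Rightarrow>\<^sub>0 nat) \<Rightarrow> ('n \<Rightarrow>\<^sub>0 nat) \<Rightarrow> 'n rpoly" where
  "box_product \<alpha> \<beta> \<equiv> mpower (\<lambda>i. 1 + Var i) \<alpha> * mpower (\<lambda>i. 1 - Var i) \<beta>"

abbreviation max_degree :: "('m::finite \<Rightarrow> ('n::finite) rpoly) \<Rightarrow> nat" where
  "max_degree g \<equiv> Max (range (\<lambda>j. total_degree (g j)))"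

text \<open>
  Constants generate only constants. The bound is what makes the index set large enough for the
  products \<open>(1 + x)\<^sup>\<alpha> (1 - x)\<^sup>\<beta>\<close>, whose degree does not depend on \<open>g\<close>.
\<close>

lemma max_degree_pos:
  fixes g :: "'m::finite \<Rightarrow> ('n::finite) rpoly"
  assumes X: "\<And>i. subst g (X i) = Var i"
  shows "max_degree g \<ge> 1"
proof (rule ccontr)
  assume "\<not> max_degree g \<ge> 1"
  moreover have "total_degree (g j) \<le> max_degree g" for j
    by (rule Max_ge) auto
  ultimately have "total_degree (g j) = 0" for j
    by (metis le_zero_eq less_one not_le)
  then have g: "degree_le 0 (g j)" for j
    using degree_le_total_degree[of "g j"] by simp
  have "degree_le 0 (subst g P)" for P
  proof (induction P rule: rpoly_induct)
    case (monomial \<alpha> c)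
    have "degree_le 0 (Const c :: 'n rpoly)" by (simp add: degree_le_def Const_def)
    then show ?case
      using degree_le_mult[of 0 "Const c" 0 "mpower g \<alpha>"] degree_le_mpower[of 0 g \<alpha>] g
      by (simp add: subst_single)
  qed (simp add: degree_le_add)
  from this[of "X undefined"] show False by (simp add: X degree_le_def Var_def)
qed

lemma degree_le_Var: "degree_le 1 (Var i)"
  by (simp add: degree_le_def Var_def)

lemma keys_in_lp_index_iff:
  "Poly_Mapping.keys p \<subseteq> lp_index g d \<longleftrightarrow> degree_le (2 * d * max_degree g) p"
  by (auto simp: lp_index_def degree_le_def)

lemma keys_localizing_product:
  assumes "expo_deg \<alpha> \<le> d" "expo_deg \<beta> \<le> d"
  shows "Poly_Mapping.keys (krivine_product g \<alpha> \<beta>) \<subseteq> lp_index g d"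
proof -
  have "degree_le (max_degree g) (g j)" for j
    by (rule degree_le_mono[OF degree_le_total_degree]) simp
  then show ?thesis unfolding keys_in_lp_index_iff
    using assms by (intro degree_le_mpower_mult degree_le_diff degree_le_one)
qed

lemma keys_box_product:
  assumes "max_degree g \<ge> 1" "expo_deg \<alpha> \<le> d" "expo_deg \<beta> \<le> d"
  shows "Poly_Mapping.keys (box_product \<alpha> \<beta>) \<subseteq> lp_index g d"
  unfolding keys_in_lp_index_iff
  using assms degree_le_mono[OF degree_le_Var assms(1)]
  by (intro degree_le_mpower_mult degree_le_diff degree_le_add degree_le_one)

lemma finite_lp_index: "finite (lp_index g d)"
  unfolding lp_index_def by (rule finite_expo_deg_le)

lemma zero_in_lp_index: "0 \<in> lp_index g d"
  by (simp add: lp_index_def)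

lemma riesz_cong:
  "(\<And>\<gamma>. \<gamma> \<in> Poly_Mapping.keys p \<Longrightarrow> y \<gamma> = z \<gamma>) \<Longrightarrow> riesz y p = riesz z p"
  by (simp add: riesz_def)

lemma riesz_minus_fun: "riesz (\<lambda>\<gamma>. y \<gamma> - z \<gamma>) p = riesz y p - riesz z p"
  by (simp add: riesz_def right_diff_distrib sum_subtractf)

lemma riesz_restrict_diff:
  "Poly_Mapping.keys p \<subseteq> I \<Longrightarrow> riesz (\<lambda>\<gamma>\<in>I. y \<gamma> - z \<gamma>) p = riesz y p - riesz z p"
  unfolding riesz_minus_fun[symmetric] by (rule riesz_cong) auto

lemma riesz_superset:
  assumes "finite I" "Poly_Mapping.keys p \<subseteq> I"
  shows "riesz y p = (\<Sum>\<gamma>\<in>I. Poly_Mapping.lookup p \<gamma> * y \<gamma>)"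
  unfolding riesz_def using assms by (intro sum.mono_neutral_left) (auto simp: in_keys_iff)

text \<open>
  The index set contains all monomials of every constraint polynomial, so the truncation in the
  definition of feasibility has no effect on the values of the Riesz functionals. Hence the
  constraints can be stated for the two functionals separately.
\<close>

lemma lp_feasible_iff:
  fixes g :: "'m::finite \<Rightarrow> ('n::finite) rpoly"
  assumes "max_degree g \<ge> 1"
  shows "y \<in> lp_feasible g B d \<longleftrightarrow> y \<in> lp_index g d \<rightarrow>\<^sub>E UNIV \<and>
    (\<forall>\<alpha> \<beta> :: 'n \<Rightarrow>\<^sub>0 nat. expo_deg \<alpha> \<le> d \<and> expo_deg \<beta> \<le> d \<longrightarrow>
        riesz y (box_product \<alpha> \<beta>) \<le>
        riesz (moments (normalized_lebesgue B)) (box_product \<alpha> \<beta>)) \<and>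
    (\<forall>\<alpha> \<beta> :: 'm \<Rightarrow>\<^sub>0 nat. expo_deg \<alpha> \<le> d \<and> expo_deg \<beta> \<le> d \<longrightarrow>
        riesz y (krivine_product g \<alpha> \<beta>) \<ge> 0)"
proof -
  have eq: "(\<Prod>i\<in>UNIV. (1 + Var i) ^ Poly_Mapping.lookup \<alpha> i * (1 - Var i) ^ Poly_Mapping.lookup \<beta> i) =
      mpower (\<lambda>i. 1 + Var i) \<alpha> * mpower (\<lambda>i. 1 - Var i :: 'n rpoly) \<beta>" for \<alpha> \<beta>
    by (simp add: mpower_def prod.distrib)
  show ?thesis
    unfolding lp_feasible_def mem_Collect_eq eq
    by (intro conj_cong arg_cong[where f=All] ext imp_cong refl)
       (simp add: riesz_restrict_diff[OF keys_box_product[OF assms]])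
qed

lemma lp_feasible_restrict:
  fixes g :: "'m::finite \<Rightarrow> ('n::finite) rpoly"
  assumes "max_degree g \<ge> 1"
    and "\<And>\<alpha> \<beta> :: 'n \<Rightarrow>\<^sub>0 nat. expo_deg \<alpha> \<le> d \<Longrightarrow> expo_deg \<beta> \<le> d \<Longrightarrow>
        riesz y (box_product \<alpha> \<beta>) \<le>
        riesz (moments (normalized_lebesgue B)) (box_product \<alpha> \<beta>)"
    and "\<And>\<alpha> \<beta> :: 'm \<Rightarrow>\<^sub>0 nat. expo_deg \<alpha> \<le> d \<Longrightarrow> expo_deg \<beta> \<le> d \<Longrightarrow>
        riesz y (krivine_product g \<alpha> \<beta>) \<ge> 0"
  shows "restrict y (lp_index g d) \<in> lp_feasible g B d"
proof -
  have "riesz (restrict y (lp_index g d)) p = riesz y p" if "Poly_Mapping.keys p \<subseteq> lp_index g d" for p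
    using that by (intro riesz_cong) auto
  note * = this[OF keys_box_product[OF assms(1)]] this[OF keys_localizing_product]
  show ?thesis
    unfolding lp_feasible_iff[OF assms(1)] by (auto simp: * assms(2,3))
qed

text \<open>
  The theorem on linear programs applies because the objective is bounded above by the mass of \<open>\<mu>\<^sub>2\<close>, through the constraint for
  \<open>\<alpha> = \<beta> = 0\<close>.
\<close>

lemma lp_optimal_exists:
  fixes g :: "'m::finite \<Rightarrow> ('n::finite) rpoly"
  assumes deg: "max_degree g \<ge> 1" and ne: "lp_feasible g B d \<noteq> {}"
  shows "\<exists>y. lp_optimal g B d y"
proof -
  let ?I = "lp_index g d"
  let ?m = "moments (normalized_lebesgue B)"
  let ?E = "\<lambda>\<alpha> \<beta>. expo_deg \<alpha> \<le> d \<and> expo_deg \<beta> \<le> d"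
  let ?p = "\<lambda>\<alpha> \<beta>. box_product \<alpha> \<beta> :: 'n rpoly"
  let ?q = "\<lambda>\<alpha> \<beta>. krivine_product g \<alpha> \<beta>"
  define C where "C =
    (\<lambda>(\<alpha>, \<beta>). (Poly_Mapping.lookup (?p \<alpha> \<beta>), riesz ?m (?p \<alpha> \<beta>))) `
      ({\<alpha>. expo_deg \<alpha> \<le> d} \<times> {\<beta>. expo_deg \<beta> \<le> d}) \<union>
    (\<lambda>(\<alpha>, \<beta>). (\<lambda>\<gamma>. - Poly_Mapping.lookup (?q \<alpha> \<beta>) \<gamma>, 0)) `
      ({\<alpha>. expo_deg \<alpha> \<le> d} \<times> {\<beta>. expo_deg \<beta> \<le> d})"
  have "finite C" unfolding C_def
    by (intro finite_UnI finite_imageI finite_cartesian_product finite_expo_deg_le)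
  have feas: "y \<in> lp_feasible g B d \<longleftrightarrow> y \<in> ?I \<rightarrow>\<^sub>E UNIV \<and> (\<forall>(a, b)\<in>C. (\<Sum>\<gamma>\<in>?I. a \<gamma> * y \<gamma>) \<le> b)" for y
  proof -
    have "riesz y (?p \<alpha> \<beta>) = (\<Sum>\<gamma>\<in>?I. Poly_Mapping.lookup (?p \<alpha> \<beta>) \<gamma> * y \<gamma>)" if "?E \<alpha> \<beta>" for \<alpha> \<beta>
      using that by (intro riesz_superset finite_lp_index keys_box_product deg) auto
    moreover have "riesz y (?q \<alpha> \<beta>) = (\<Sum>\<gamma>\<in>?I. Poly_Mapping.lookup (?q \<alpha> \<beta>) \<gamma> * y \<gamma>)" if "?E \<alpha> \<beta>" for \<alpha> \<beta>
      using that by (intro riesz_superset finite_lp_index keys_localizing_product) auto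
    moreover have "(\<forall>(a, b)\<in>C. (\<Sum>\<gamma>\<in>?I. a \<gamma> * y \<gamma>) \<le> b) \<longleftrightarrow>
        (\<forall>\<alpha> \<beta>. ?E \<alpha> \<beta> \<longrightarrow> (\<Sum>\<gamma>\<in>?I. Poly_Mapping.lookup (?p \<alpha> \<beta>) \<gamma> * y \<gamma>) \<le> riesz ?m (?p \<alpha> \<beta>)) \<and>
        (\<forall>\<alpha> \<beta>. ?E \<alpha> \<beta> \<longrightarrow> 0 \<le> (\<Sum>\<gamma>\<in>?I. Poly_Mapping.lookup (?q \<alpha> \<beta>) \<gamma> * y \<gamma>))"
      unfolding C_def ball_Un by (auto simp: sum_negf)
    ultimately show ?thesis
      unfolding lp_feasible_iff[OF deg] by simp
  qed
  obtain y0 where "y0 \<in> lp_feasible g B d" using ne by blast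
  have restr: "restrict y ?I \<in> lp_feasible g B d" if "\<And>a b. (a, b) \<in> C \<Longrightarrow> (\<Sum>\<gamma>\<in>?I. a \<gamma> * y \<gamma>) \<le> b" for y
    using that unfolding feas by fastforce
  have bound: "y 0 \<le> ?m 0" if "y \<in> lp_feasible g B d" for y
  proof -
    have "riesz y (?p 0 0) \<le> riesz ?m (?p 0 0)"
      using that unfolding lp_feasible_iff[OF deg] by (metis expo_deg_zero le0)
    then show ?thesis by (simp add: riesz_one)
  qed
  obtain y where y: "\<And>a b. (a, b) \<in> C \<Longrightarrow> (\<Sum>\<gamma>\<in>?I. a \<gamma> * y \<gamma>) \<le> b"
    "\<And>z. (\<And>a b. (a, b) \<in> C \<Longrightarrow> (\<Sum>\<gamma>\<in>?I. a \<gamma> * z \<gamma>) \<le> b) \<Longrightarrow> z 0 \<le> y 0"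
  proof (rule linear_program_attains_max[where w = y0 and M = "?m 0",
      OF finite_lp_index \<open>finite C\<close> zero_in_lp_index])
    fix z assume "\<And>a b. (a, b) \<in> C \<Longrightarrow> (\<Sum>\<gamma>\<in>?I. a \<gamma> * z \<gamma>) \<le> b"
    from bound[OF restr[OF this]] show "z 0 \<le> ?m 0" by (simp add: zero_in_lp_index)
  qed (use \<open>y0 \<in> _\<close> in \<open>auto simp: feas\<close>)
  have "lp_optimal g B d (restrict y ?I)"
    unfolding lp_optimal_def
  proof (intro conjI ballI)
    show "restrict y ?I \<in> lp_feasible g B d" by (rule restr[OF y(1)])
    fix z assume "z \<in> lp_feasible g B d"
    then have "z 0 \<le> y 0" by (intro y(2)) (auto simp: feas)
    then show "z 0 \<le> restrict y ?I 0" by (simp add: zero_in_lp_index)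
  qed
  then show ?thesis by (intro exI[of _ "restrict y ?I"])
qed

lemma lp_value_optimal: "lp_optimal g B d y \<Longrightarrow> lp_value g B d = y 0"
  unfolding lp_optimal_def lp_value_def by (intro cSup_eq_maximum) auto

lemma lp_feasible_mono:
  assumes "max_degree g \<ge> 1" "d \<le> e" "y \<in> lp_feasible g B e"
  shows "restrict y (lp_index g d) \<in> lp_feasible g B d"
proof (rule lp_feasible_restrict[OF assms(1)])
  note y = assms(3)[unfolded lp_feasible_iff[OF assms(1)]]
  show "riesz y (box_product \<alpha> \<beta>) \<le>
      riesz (moments (normalized_lebesgue B)) (box_product \<alpha> \<beta>)"
    if "expo_deg \<alpha> \<le> d" "expo_deg \<beta> \<le> d" for \<alpha> \<beta>
    using y that assms(2) by (meson order_trans)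
  show "riesz y (krivine_product g \<alpha> \<beta>) \<ge> 0"
    if "expo_deg \<alpha> \<le> d" "expo_deg \<beta> \<le> d" for \<alpha> \<beta>
    using y that assms(2) by (meson order_trans)
qed

section \<open>Positive polynomials and feasible vectors\<close>

lemma krivine_cone_riesz_nonneg:
  assumes "p \<in> krivine_cone g"
  shows "\<exists>D. \<forall>d\<ge>D. \<forall>y. (\<forall>\<alpha> \<beta>. expo_deg \<alpha> \<le> d \<and> expo_deg \<beta> \<le> d \<longrightarrow>
      riesz y (krivine_product g \<alpha> \<beta>) \<ge> 0) \<longrightarrow> riesz y p \<ge> 0"
  using assms
proof (induction rule: krivine_cone.induct)
  case (add p c \<alpha> \<beta>)
  then obtain D where "\<forall>d\<ge>D. \<forall>y. (\<forall>\<alpha> \<beta>. expo_deg \<alpha> \<le> d \<and> expo_deg \<beta> \<le> d \<longrightarrow>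
      riesz y (krivine_product g \<alpha> \<beta>) \<ge> 0) \<longrightarrow> riesz y p \<ge> 0" by blast
  with add(2) show ?case
    by (intro exI[of _ "max D (max (expo_deg \<alpha>) (expo_deg \<beta>))"])
       (auto simp: riesz_add riesz_Const_mult)
qed simp

lemma positive_imp_feasible_nonneg:
  fixes g :: "'m::finite \<Rightarrow> ('n::finite) rpoly"
  assumes X: "\<And>i. subst g (X i) = Var i"
    and pos: "\<And>x. (\<And>j. 0 \<le> poly_eval (g j) x \<and> poly_eval (g j) x \<le> 1) \<Longrightarrow> poly_eval f x > 0"
  shows "\<exists>D. \<forall>d\<ge>D. \<forall>y\<in>lp_feasible g B d. riesz y f \<ge> 0"
  using krivine_cone_riesz_nonneg[OF krivine_positivstellensatz[of g X f, OF X pos]]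
  by (auto simp: lp_feasible_def) metis

text \<open>
  The positivity theorem for the generators \<open>(1 + x\<^sub>i) / 2\<close>, whose complements are
  \<open>(1 - x\<^sub>i) / 2\<close>: the products in its certificates are positive multiples of the constraint
  polynomials of the program.
\<close>

lemma positive_on_box_imp_feasible_le:
  fixes g :: "'m::finite \<Rightarrow> ('n::finite) rpoly"
  assumes deg: "max_degree g \<ge> 1"
    and pos: "\<And>x. (\<And>i. - 1 \<le> x $ i \<and> x $ i \<le> 1) \<Longrightarrow> poly_eval f x > 0"
  shows "\<exists>D. \<forall>d\<ge>D. \<forall>y\<in>lp_feasible g B d. riesz y f \<le> riesz (moments (normalized_lebesgue B)) f"
proof -
  define h :: "'n \<Rightarrow> 'n rpoly" where "h = (\<lambda>i. Const (1 / 2) * (1 + Var i))"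
  have half: "Const (1 / 2) + Const (1 / 2) = (1 :: 'n rpoly)"
    by (simp add: Const_add[symmetric] Const_one)
  have h': "1 - h i = Const (1 / 2) * (1 - Var i)" for i
    unfolding h_def using half by (simp add: algebra_simps)
  have "subst h (Const 2 * Var i - 1) = Var i" for i
    unfolding subst_diff subst_mult subst_Const subst_Var subst_one h_def
      mult.assoc[symmetric] Const_mult[symmetric]
    by (simp add: Const_one)
  then have "f \<in> krivine_cone h"
  proof (rule krivine_positivstellensatz)
    fix x assume h: "\<And>j. 0 \<le> poly_eval (h j) x \<and> poly_eval (h j) x \<le> 1"
    have "- 1 \<le> x $ i \<and> x $ i \<le> 1" for i using h[of i] by (simp add: h_def)
    then show "poly_eval f x > 0" by (rule pos)
  qed
  then obtain D where D: "\<And>d y. d \<ge> D \<Longrightarrow> (\<And>\<alpha> \<beta>. expo_deg \<alpha> \<le> d \<Longrightarrow> expo_deg \<beta> \<le> d \<Longrightarrow>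
      riesz y (krivine_product h \<alpha> \<beta>) \<ge> 0) \<Longrightarrow> riesz y f \<ge> 0"
    using krivine_cone_riesz_nonneg by metis
  have prod: "krivine_product h \<alpha> \<beta> =
      Const (mpower (\<lambda>_. 1 / 2) \<alpha> * mpower (\<lambda>_. 1 / 2) \<beta>) * (box_product \<alpha> \<beta>)" for \<alpha> \<beta>
  proof -
    have "mpower (\<lambda>_::'n. Const a) \<alpha> = (Const (mpower (\<lambda>_. a) \<alpha>) :: 'n rpoly)" for a \<alpha>
      by (simp add: mpower_def Const_prod Const_power)
    then show ?thesis
      unfolding h' unfolding h_def by (simp add: mpower_mult Const_mult mult_ac)
  qed
  have "riesz y f \<le> riesz (moments (normalized_lebesgue B)) f" if "d \<ge> D" "y \<in> lp_feasible g B d" for d y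
  proof -
    have "0 \<le> riesz (\<lambda>\<gamma>. moments (normalized_lebesgue B) \<gamma> - y \<gamma>) f"
    proof (rule D[OF that(1)])
      fix \<alpha> \<beta> :: "'n \<Rightarrow>\<^sub>0 nat" assume "expo_deg \<alpha> \<le> d" "expo_deg \<beta> \<le> d"
      then have "riesz y (box_product \<alpha> \<beta>) \<le>
          riesz (moments (normalized_lebesgue B)) (box_product \<alpha> \<beta>)"
        using that(2) unfolding lp_feasible_iff[OF deg] by blast
      moreover have "0 \<le> mpower (\<lambda>_::'n. 1 / 2 :: real) \<alpha> * mpower (\<lambda>_. 1 / 2) \<beta>"
        unfolding mpower_def by (intro mult_nonneg_nonneg prod_nonneg) auto
      ultimately show "0 \<le> riesz (\<lambda>\<gamma>. moments (normalized_lebesgue B) \<gamma> - y \<gamma>) (krivine_product h \<alpha> \<beta>)"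
        unfolding prod riesz_Const_mult riesz_minus_fun by (simp only: diff_ge_0_iff_ge mult_left_mono)
    qed
    then show ?thesis by (simp add: riesz_minus_fun)
  qed
  then show ?thesis by blast
qed

section \<open>Integration against the normalized Lebesgue measure\<close>

definition symmetric_cube :: "(real ^ 'n) set" where
  "symmetric_cube = {x. \<forall>i. - 1 \<le> x $ i \<and> x $ i \<le> 1}"

lemma compact_symmetric_cube: "compact (symmetric_cube :: (real ^ 'n::finite) set)"
proof -
  have "symmetric_cube = (cbox (\<chi> i. - 1) (\<chi> i. 1) :: (real ^ 'n) set)"
    by (auto simp: symmetric_cube_def mem_box_cart)
  then show ?thesis by (metis compact_cbox)
qed

lemma space_normalized_lebesgue [simp]: "space (normalized_lebesgue B) = B"
  by (simp add: normalized_lebesgue_def space_scale_measure space_restrict_space)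

lemma sets_normalized_lebesgue:
  "B \<in> sets borel \<Longrightarrow> A \<in> sets (normalized_lebesgue B) \<longleftrightarrow> A \<subseteq> B \<and> A \<in> sets borel"
  unfolding normalized_lebesgue_def sets_scale_measure by (subst sets_restrict_space_iff) auto

lemma emeasure_normalized_lebesgue:
  fixes B :: "(real ^ 'n::finite) set"
  assumes "B \<in> sets borel" "A \<subseteq> B"
  shows "emeasure (normalized_lebesgue B) A = ennreal (1 / 2 ^ CARD('n)) * emeasure lborel A"
  unfolding normalized_lebesgue_def emeasure_scale_measure
  using assms by (subst emeasure_restrict_space) auto

lemma measure_normalized_lebesgue:
  fixes B :: "(real ^ 'n::finite) set"
  assumes "B \<in> sets borel" "A \<subseteq> B"
  shows "measure (normalized_lebesgue B) A = measure lborel A / 2 ^ CARD('n)"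
  unfolding measure_def emeasure_normalized_lebesgue[OF assms] enn2real_mult by simp

definition moments_on :: "(real ^ 'n::finite) set \<Rightarrow> (real ^ 'n) set \<Rightarrow> ('n \<Rightarrow>\<^sub>0 nat) \<Rightarrow> real" where
  "moments_on B K \<alpha> = (LINT x:K|normalized_lebesgue B. mpower (\<lambda>i. x $ i) \<alpha>)"

text \<open>
  Continuous functions that decrease to the indicator of \<open>semialg_set g\<close>. Penalizing the violation
  of the inequalities, rather than using the distance to the set, also covers the empty set.
\<close>

definition cutoff :: "('m::finite \<Rightarrow> ('n::finite) rpoly) \<Rightarrow> nat \<Rightarrow> real ^ 'n \<Rightarrow> real" where
  "cutoff g k x = 1 / (1 + real k * (\<Sum>j\<in>UNIV. max 0 (- poly_eval (g j) x)))"

lemma violation_nonneg: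
  fixes g :: "'m::finite \<Rightarrow> ('n::finite) rpoly"
  shows "0 \<le> (\<Sum>j\<in>UNIV. max 0 (- poly_eval (g j) x))"
  by (intro sum_nonneg) auto

lemma violation_zero_iff:
  fixes g :: "'m::finite \<Rightarrow> ('n::finite) rpoly"
  shows "(\<Sum>j\<in>UNIV. max 0 (- poly_eval (g j) x)) = 0 \<longleftrightarrow> x \<in> semialg_set g"
proof -
  have "max 0 (- a) = 0 \<longleftrightarrow> 0 \<le> a" for a :: real by (simp add: max_def)
  then show ?thesis by (subst sum_nonneg_eq_0_iff) (auto simp: semialg_set_def)
qed

lemma cutoff_bounds: "0 \<le> cutoff g k x" "cutoff g k x \<le> 1"
proof -
  have "1 + real k * (\<Sum>j\<in>UNIV. max 0 (- poly_eval (g j) x)) \<ge> 1"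
    using violation_nonneg[of g x] by simp
  then show "0 \<le> cutoff g k x" "cutoff g k x \<le> 1" by (simp_all add: cutoff_def)
qed

lemma cutoff_on: "x \<in> semialg_set g \<Longrightarrow> cutoff g k x = 1"
  using violation_zero_iff[of g x] by (simp add: cutoff_def)

lemma continuous_on_cutoff: "continuous_on S (cutoff g k)"
proof -
  have "1 + real k * (\<Sum>j\<in>UNIV. max 0 (- poly_eval (g j) x)) \<noteq> 0" for x
    using mult_nonneg_nonneg[OF of_nat_0_le_iff[of k] violation_nonneg[of g x]] by linarith
  then show ?thesis unfolding cutoff_def by (intro continuous_intros ballI)
qed

lemma cutoff_tendsto: "(\<lambda>k. cutoff g k x) \<longlonglongrightarrow> indicator (semialg_set g) x"
proof (cases "x \<in> semialg_set g")
  case True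
  then show ?thesis by (simp add: cutoff_on)
next
  case False
  define s where "s = (\<Sum>j\<in>UNIV. max 0 (- poly_eval (g j) x))"
  have "s > 0"
    using False violation_nonneg[of g x] violation_zero_iff[of g x] unfolding s_def by linarith
  then have "filterlim (\<lambda>k. 1 + real k * s) at_top sequentially"
    by (intro filterlim_tendsto_add_at_top[OF tendsto_const]
        filterlim_at_top_mult_tendsto_pos[OF tendsto_const] filterlim_real_sequentially)
  then have "(\<lambda>k. inverse (1 + real k * s)) \<longlonglongrightarrow> 0"
    by (rule tendsto_inverse_0_at_top)
  then show ?thesis using False by (simp add: cutoff_def s_def[symmetric] inverse_eq_divide)
qed

lemma polynomial_approximation:
  fixes h :: "real ^ 'n::finite \<Rightarrow> real"
  assumes "continuous_on symmetric_cube h" "\<eta> > 0"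
  obtains f where "\<And>x. x \<in> symmetric_cube \<Longrightarrow> h x < poly_eval f x \<and> poly_eval f x < h x + 2 * \<eta>"
proof -
  have "\<exists>f. (\<exists>p. f = poly_eval p) \<and> (\<forall>x\<in>symmetric_cube. \<bar>(h x + \<eta>) - f x\<bar> < \<eta>)"
  proof (rule Stone_Weierstrass_HOL)
    show "\<exists>p. (\<lambda>x. c) = (poly_eval p :: real ^ 'n \<Rightarrow> real)" for c
      by (rule exI[of _ "Const c"]) auto
    show "\<exists>f. (\<exists>p. f = poly_eval p) \<and> f x \<noteq> f y"
      if "x \<in> symmetric_cube \<and> y \<in> symmetric_cube \<and> x \<noteq> y" for x y :: "real ^ 'n"
    proof -
      from that obtain i where "x $ i \<noteq> y $ i" by (auto simp: vec_eq_iff)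
      then show ?thesis by (intro exI[of _ "poly_eval (Var i)"]) auto
    qed
    show "\<exists>p. (\<lambda>x. f x + g x) = poly_eval p" if "(\<exists>p. f = poly_eval p) \<and> (\<exists>p. g = poly_eval p)"
      for f g :: "real ^ 'n \<Rightarrow> real"
    proof -
      from that obtain p q where "f = poly_eval p" "g = poly_eval q" by blast
      then show ?thesis by (intro exI[of _ "p + q"]) auto
    qed
    show "\<exists>p. (\<lambda>x. f x * g x) = poly_eval p" if "(\<exists>p. f = poly_eval p) \<and> (\<exists>p. g = poly_eval p)"
      for f g :: "real ^ 'n \<Rightarrow> real"
    proof -
      from that obtain p q where "f = poly_eval p" "g = poly_eval q" by blast
      then show ?thesis by (intro exI[of _ "p * q"]) auto
    qed
  qed (use assms compact_symmetric_cube continuous_on_poly_eval in \<open>auto intro!: continuous_intros\<close>)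
  then obtain p where "\<forall>x\<in>symmetric_cube. \<bar>(h x + \<eta>) - poly_eval p x\<bar> < \<eta>" by blast
  then show ?thesis by (intro that[of p]) (auto simp: abs_less_iff)
qed

context
  fixes B :: "(real ^ 'n::finite) set"
  assumes B_borel: "B \<in> sets borel" and B_box: "B \<subseteq> symmetric_cube"
begin

lemma finite_measure_normalized_lebesgue: "finite_measure (normalized_lebesgue B)"
proof
  have "bounded B" using B_box compact_symmetric_cube bounded_subset compact_imp_bounded by blast
  then have "emeasure lborel B < \<infinity>" by (rule emeasure_bounded_finite)
  then show "emeasure (normalized_lebesgue B) (space (normalized_lebesgue B)) \<noteq> \<infinity>"
    using emeasure_normalized_lebesgue[OF B_borel order_refl]
    by (simp add: ennreal_mult_eq_top_iff less_top)
qed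

lemma integrable_continuous:
  fixes f :: "real ^ 'n \<Rightarrow> real"
  assumes f: "continuous_on UNIV f"
  shows "integrable (normalized_lebesgue B) f"
proof -
  interpret finite_measure "normalized_lebesgue B" by (rule finite_measure_normalized_lebesgue)
  have "f \<in> borel_measurable borel" using f by (rule borel_measurable_continuous_onI)
  then have "f \<in> borel_measurable lborel" by simp
  then have "f \<in> borel_measurable (restrict_space lborel B)" by (rule measurable_restrict_space1)
  then have meas: "f \<in> borel_measurable (normalized_lebesgue B)"
    by (simp add: normalized_lebesgue_def)
  have "compact (f ` symmetric_cube)"
    using f compact_symmetric_cube by (meson compact_continuous_image continuous_on_subset subset_UNIV)
  then obtain C where "\<And>x. x \<in> symmetric_cube \<Longrightarrow> norm (f x) \<le> C"
    by (meson bounded_iff compact_imp_bounded image_eqI)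
  with B_box show ?thesis by (intro integrable_const_bound[of f C] meas AE_I2) auto
qed

lemma integrable_poly_eval: "integrable (normalized_lebesgue B) (poly_eval p)"
  by (intro integrable_continuous continuous_on_poly_eval)

lemma integrable_mpower: "integrable (normalized_lebesgue B) (\<lambda>x. mpower (\<lambda>i. x $ i) \<alpha>)"
proof -
  have "(\<lambda>x. mpower (\<lambda>i. x $ i) \<alpha>) = poly_eval (Poly_Mapping.single \<alpha> 1)"
    by (rule ext) simp
  then show ?thesis by (simp only: integrable_poly_eval)
qed

lemma riesz_moments:
  "riesz (moments (normalized_lebesgue B)) p = (\<integral>x. poly_eval p x \<partial>normalized_lebesgue B)"
  unfolding riesz_def moments_def poly_eval_def
  by (subst Bochner_Integration.integral_sum) (auto intro!: integrable_mult_right integrable_mpower)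

lemma riesz_moments_on:
  assumes "K \<in> sets (normalized_lebesgue B)"
  shows "riesz (moments_on B K) p = (LINT x:K|normalized_lebesgue B. poly_eval p x)"
proof -
  have "riesz (moments_on B K) p = (\<Sum>\<alpha>\<in>Poly_Mapping.keys p.
      (\<integral>x. Poly_Mapping.lookup p \<alpha> * (indicator K x *\<^sub>R mpower (\<lambda>i. x $ i) \<alpha>) \<partial>normalized_lebesgue B))"
    by (simp add: riesz_def moments_on_def set_lebesgue_integral_def)
  also have "\<dots> = (\<integral>x. (\<Sum>\<alpha>\<in>Poly_Mapping.keys p.
      Poly_Mapping.lookup p \<alpha> * (indicator K x *\<^sub>R mpower (\<lambda>i. x $ i) \<alpha>)) \<partial>normalized_lebesgue B)"
    by (rule Bochner_Integration.integral_sum[symmetric])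
       (intro integrable_mult_right integrable_mult_indicator assms integrable_mpower)
  also have "\<dots> = (LINT x:K|normalized_lebesgue B. poly_eval p x)"
    unfolding set_lebesgue_integral_def poly_eval_def
    by (intro Bochner_Integration.integral_cong refl) (simp add: sum_distrib_left algebra_simps)
  finally show ?thesis .
qed

lemma integral_on_le:
  assumes "K \<in> sets (normalized_lebesgue B)"
    and "\<And>x. x \<in> B \<Longrightarrow> poly_eval p x \<ge> 0"
  shows "riesz (moments_on B K) p \<le> riesz (moments (normalized_lebesgue B)) p"
  unfolding riesz_moments riesz_moments_on[OF assms(1)] set_lebesgue_integral_def
  using assms
  by (intro integral_mono integrable_mult_indicator integrable_poly_eval)
     (auto simp: indicator_def)

lemma integral_on_nonneg:
  assumes "K \<in> sets (normalized_lebesgue B)"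
    and "\<And>x. x \<in> K \<Longrightarrow> poly_eval p x \<ge> 0"
  shows "0 \<le> riesz (moments_on B K) p"
  unfolding riesz_moments_on[OF assms(1)] set_lebesgue_integral_def
  using assms(2) by (intro Bochner_Integration.integral_nonneg) (auto simp: indicator_def)

lemma restricted_moments_feasible:
  fixes g :: "'m::finite \<Rightarrow> 'n rpoly"
  assumes deg: "max_degree g \<ge> 1"
    and K: "semialg_set g \<in> sets (normalized_lebesgue B)"
    and g: "\<And>j x. x \<in> semialg_set g \<Longrightarrow> 0 \<le> poly_eval (g j) x \<and> poly_eval (g j) x \<le> 1"
  shows "restrict (moments_on B (semialg_set g)) (lp_index g d) \<in> lp_feasible g B d"
proof (rule lp_feasible_restrict[OF deg])
  fix \<alpha> \<beta> :: "'n \<Rightarrow>\<^sub>0 nat"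
  show "riesz (moments_on B (semialg_set g)) (box_product \<alpha> \<beta>)
    \<le> riesz (moments (normalized_lebesgue B)) (box_product \<alpha> \<beta>)"
  proof (rule integral_on_le[OF K])
    fix x assume "x \<in> B"
    then have "- 1 \<le> x $ i \<and> x $ i \<le> 1" for i using B_box by (auto simp: symmetric_cube_def)
    then have "0 \<le> 1 + x $ i" "0 \<le> 1 - x $ i" for i by (smt (verit))+
    then show "0 \<le> poly_eval (box_product \<alpha> \<beta>) x"
      unfolding poly_eval_mult poly_eval_mpower by (intro mult_nonneg_nonneg mpower_nonneg) simp_all
  qed
next
  fix \<alpha> \<beta> :: "'m \<Rightarrow>\<^sub>0 nat"
  show "0 \<le> riesz (moments_on B (semialg_set g)) (krivine_product g \<alpha> \<beta>)"
  proof (rule integral_on_nonneg[OF K])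
    fix x assume "x \<in> semialg_set g"
    from g[OF this] show "0 \<le> poly_eval (krivine_product g \<alpha> \<beta>) x"
      unfolding poly_eval_mult poly_eval_mpower by (intro mult_nonneg_nonneg mpower_nonneg) simp_all
  qed
qed

lemma integral_cutoff_tendsto:
  assumes K: "semialg_set g \<in> sets (normalized_lebesgue B)"
  shows "(\<lambda>k. \<integral>x. cutoff g k x * poly_eval q x \<partial>normalized_lebesgue B)
    \<longlonglongrightarrow> riesz (moments_on B (semialg_set g)) q"
  unfolding riesz_moments_on[OF K] set_lebesgue_integral_def real_scaleR_def
proof (rule integral_dominated_convergence)
  show "(\<lambda>x. indicator (semialg_set g) x * poly_eval q x) \<in> borel_measurable (normalized_lebesgue B)"
    using integrable_mult_indicator[OF K integrable_poly_eval[of q]]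
    by (simp add: borel_measurable_integrable)
  show "(\<lambda>x. cutoff g k x * poly_eval q x) \<in> borel_measurable (normalized_lebesgue B)" for k
    by (intro borel_measurable_integrable integrable_continuous continuous_intros
        continuous_on_cutoff continuous_on_poly_eval)
  show "integrable (normalized_lebesgue B) (\<lambda>x. \<bar>poly_eval q x\<bar>)"
    by (intro integrable_abs integrable_poly_eval)
  show "AE x in normalized_lebesgue B.
      (\<lambda>k. cutoff g k x * poly_eval q x) \<longlonglongrightarrow> indicator (semialg_set g) x * poly_eval q x"
    by (intro AE_I2 tendsto_mult tendsto_const cutoff_tendsto)
  show "AE x in normalized_lebesgue B. norm (cutoff g k x * poly_eval q x) \<le> \<bar>poly_eval q x\<bar>" for k
    using cutoff_bounds[of g k] by (intro AE_I2) (simp add: abs_mult mult_left_le_one_le)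
qed

section \<open>Convergence of optimal values and optimal solutions\<close>

text \<open>
  Multiplying \<open>q\<close> by a polynomial \<open>f\<close> just above a cutoff function increases \<open>q\<close> on \<open>K\<close>, which
  the constraints on \<open>K\<close> see, while its integral over the cube drops to almost the integral over
  \<open>K\<close>, which is what the constraints on the cube see.
\<close>

lemma feasible_asymptotic_upper_bound:
  fixes g :: "'m::finite \<Rightarrow> 'n rpoly"
  assumes X: "\<And>i. subst g (X i) = Var i"
    and K: "semialg_set g \<in> sets (normalized_lebesgue B)"
    and q: "\<And>x. x \<in> symmetric_cube \<Longrightarrow> poly_eval q x > 0"
    and e: "e > 0"
  shows "\<exists>D. \<forall>d\<ge>D. \<forall>y\<in>lp_feasible g B d. riesz y q < riesz (moments_on B (semialg_set g)) q + e"
proof -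
  let ?M = "normalized_lebesgue B"
  have KB: "semialg_set g \<subseteq> symmetric_cube"
    using K B_box by (auto simp: sets_normalized_lebesgue[OF B_borel])
  have "\<forall>\<^sub>F k in sequentially. (\<integral>x. cutoff g k x * poly_eval q x \<partial>?M)
      < riesz (moments_on B (semialg_set g)) q + e / 2"
    using integral_cutoff_tendsto[OF K, of q] e by (intro order_tendstoD(2)) auto
  then obtain k where k: "(\<integral>x. cutoff g k x * poly_eval q x \<partial>?M)
      < riesz (moments_on B (semialg_set g)) q + e / 2"
    using eventually_happens'[OF sequentially_bot] by blast
  define c where "c = (\<integral>x. poly_eval q x \<partial>?M)"
  have c: "c \<ge> 0" unfolding c_def using q B_box
    by (intro Bochner_Integration.integral_nonneg) (auto intro: less_imp_le)
  \<comment> \<open>The error \<open>2 * \<eta>\<close> of the approximation contributes at most \<open>2 * \<eta> * c\<close> to the integral.\<close>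
  define \<eta> where "\<eta> = e / (4 * (1 + c))"
  have \<eta>: "\<eta> > 0" "2 * \<eta> * c \<le> e / 2" using e c by (auto simp: \<eta>_def field_simps)
  obtain f where f: "\<And>x. x \<in> symmetric_cube \<Longrightarrow>
      cutoff g k x < poly_eval f x \<and> poly_eval f x < cutoff g k x + 2 * \<eta>"
    using polynomial_approximation[OF continuous_on_cutoff \<eta>(1)] by blast
  have "riesz (moments ?M) (f * q) = (\<integral>x. poly_eval f x * poly_eval q x \<partial>?M)"
    by (simp add: riesz_moments)
  also have "\<dots> \<le> (\<integral>x. cutoff g k x * poly_eval q x + 2 * \<eta> * poly_eval q x \<partial>?M)"
  proof (rule integral_mono)
    show "integrable ?M (\<lambda>x. poly_eval f x * poly_eval q x)"
      "integrable ?M (\<lambda>x. cutoff g k x * poly_eval q x + 2 * \<eta> * poly_eval q x)"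
      by (intro integrable_continuous continuous_intros continuous_on_cutoff continuous_on_poly_eval)+
    fix x assume "x \<in> space ?M"
    then have "x \<in> symmetric_cube" using B_box by auto
    with f q have "poly_eval f x * poly_eval q x \<le> (cutoff g k x + 2 * \<eta>) * poly_eval q x"
      by (intro mult_right_mono) (auto intro: less_imp_le)
    then show "poly_eval f x * poly_eval q x \<le> cutoff g k x * poly_eval q x + 2 * \<eta> * poly_eval q x"
      by (simp add: distrib_right)
  qed
  also have "\<dots> = (\<integral>x. cutoff g k x * poly_eval q x \<partial>?M) + 2 * \<eta> * c"
  proof -
    have "integrable ?M (\<lambda>x. cutoff g k x * poly_eval q x)" "integrable ?M (\<lambda>x. 2 * \<eta> * poly_eval q x)"
      by (intro integrable_continuous continuous_intros continuous_on_cutoff continuous_on_poly_eval)+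
    then show ?thesis by (simp add: c_def)
  qed
  finally have fq: "riesz (moments ?M) (f * q) < riesz (moments_on B (semialg_set g)) q + e"
    using k \<eta>(2) by linarith
  obtain D1 where D1: "\<And>d y. d \<ge> D1 \<Longrightarrow> y \<in> lp_feasible g B d \<Longrightarrow> riesz y (f * q - q) \<ge> 0"
  proof -
    have "poly_eval (f * q - q) x > 0" if "\<And>j. 0 \<le> poly_eval (g j) x \<and> poly_eval (g j) x \<le> 1" for x
    proof -
      have x: "x \<in> semialg_set g" using that by (simp add: semialg_set_def)
      with KB have "x \<in> symmetric_cube" by blast
      then have "1 < poly_eval f x" "poly_eval q x > 0"
        using f[of x] q[of x] cutoff_on[OF x, of k] by auto
      then show ?thesis by simp
    qed
    from positive_imp_feasible_nonneg[of g X, OF X this] that show ?thesis by metis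
  qed
  obtain D2 where D2: "\<And>d y. d \<ge> D2 \<Longrightarrow> y \<in> lp_feasible g B d \<Longrightarrow>
      riesz y (f * q) \<le> riesz (moments ?M) (f * q)"
  proof -
    have "poly_eval (f * q) x > 0" if "\<And>i. - 1 \<le> x $ i \<and> x $ i \<le> 1" for x
    proof -
      have "x \<in> symmetric_cube" using that by (simp add: symmetric_cube_def)
      then have "poly_eval f x > 0" "poly_eval q x > 0"
        using f[of x] q[of x] cutoff_bounds(1)[of g k x] by linarith+
      then show ?thesis by simp
    qed
    from positive_on_box_imp_feasible_le[of g, OF max_degree_pos[of g X, OF X] this] that
    show ?thesis by metis
  qed
  show ?thesis
  proof (intro exI[of _ "max D1 D2"] allI impI ballI)
    fix d y assume "max D1 D2 \<le> d" and y: "y \<in> lp_feasible g B d"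
    then have "riesz y q \<le> riesz y (f * q)" using D1[OF _ y] by (simp add: riesz_diff)
    also have "\<dots> \<le> riesz (moments ?M) (f * q)" using D2[OF _ y] \<open>max D1 D2 \<le> d\<close> by simp
    finally show "riesz y q < riesz (moments_on B (semialg_set g)) q + e" using fq by linarith
  qed
qed

text \<open>
  For \<open>q = 2 \<plusminus> x\<^sup>\<alpha>\<close> the upper bounds read \<open>2 y\<^sub>0 \<plusminus> y\<^sub>\<alpha> < 2 m\<^sub>0 \<plusminus> m\<^sub>\<alpha> + e / 4\<close>, where \<open>m\<close> is
  the limit. Optimality gives \<open>m\<^sub>0 \<le> y\<^sub>0\<close>, and the two bounds become
  \<open>\<bar>y\<^sub>\<alpha> - m\<^sub>\<alpha>\<bar> < e / 4\<close>. The constant \<open>2\<close> makes \<open>q\<close> strictly positive, as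
  \<open>\<bar>x\<^sup>\<alpha>\<bar> \<le> 1\<close> on the cube.
\<close>

lemma optimal_moments_tendsto:
  fixes g :: "'m::finite \<Rightarrow> 'n rpoly"
  assumes X: "\<And>i. subst g (X i) = Var i"
    and K: "semialg_set g \<in> sets (normalized_lebesgue B)"
    and g: "\<And>j x. x \<in> semialg_set g \<Longrightarrow> 0 \<le> poly_eval (g j) x \<and> poly_eval (g j) x \<le> 1"
    and y: "\<And>d. lp_optimal g B d (y d)"
  shows "(\<lambda>d. y d \<alpha>) \<longlonglongrightarrow> moments_on B (semialg_set g) \<alpha>"
proof -
  let ?m = "moments_on B (semialg_set g)"
  have deg: "max_degree g \<ge> 1" by (rule max_degree_pos[of g X, OF X])
  have feas: "y d \<in> lp_feasible g B d" for d using y by (simp add: lp_optimal_def)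
  have lower: "?m 0 \<le> y d 0" for d
    using y[of d] restricted_moments_feasible[OF deg K g, of d] zero_in_lp_index[of g d]
    unfolding lp_optimal_def by fastforce
  have upper: "\<forall>\<^sub>F d in sequentially. riesz (y d) q < riesz ?m q + e"
    if "\<And>x. x \<in> symmetric_cube \<Longrightarrow> poly_eval q x > 0" "e > 0" for q e
    using feasible_asymptotic_upper_bound[of g X q e, OF X K that] feas
    unfolding eventually_at_top_linorder by blast
  show ?thesis
  proof (rule tendstoI)
    fix e :: real assume e: "e > 0"
    have mono: "\<bar>mpower (\<lambda>i. x $ i) \<alpha>\<bar> \<le> 1" if "x \<in> symmetric_cube" for x
      using that unfolding mpower_def abs_prod power_abs
      by (intro prod_le_1 conjI zero_le_power power_le_one)
         (auto simp: symmetric_cube_def abs_le_iff minus_le_iff)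
    define q where "q = (\<lambda>s. Const 2 + Const s * Poly_Mapping.single \<alpha> 1 :: 'n rpoly)"
    have q_pos: "poly_eval (q s) x > 0" if "x \<in> symmetric_cube" "s = 1 \<or> s = - 1" for s x
      using mono[OF that(1)] that(2) by (auto simp: q_def abs_le_iff)
    have q_riesz: "riesz z (q s) = 2 * z 0 + s * z \<alpha>" for z s
      by (simp add: q_def riesz_add riesz_Const_mult riesz_single riesz_Const)
    have "\<forall>\<^sub>F d in sequentially. riesz (y d) (q 1) < riesz ?m (q 1) + e / 4"
      using e q_pos by (intro upper) auto
    moreover have "\<forall>\<^sub>F d in sequentially. riesz (y d) (q (- 1)) < riesz ?m (q (- 1)) + e / 4"
      using e q_pos by (intro upper) auto
    ultimately show "\<forall>\<^sub>F d in sequentially. dist (y d \<alpha>) (?m \<alpha>) < e"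
    proof eventually_elim
      case (elim d)
      then show ?case using lower[of d] e unfolding q_riesz riesz_one dist_real_def by linarith
    qed
  qed
qed

end

theorem theorem3p5:
  fixes g :: "'m::finite \<Rightarrow> ('n::finite) rpoly"
    and B :: "(real ^ 'n) set"
  assumes "compact (semialg_set g)"
    and "semialg_set g \<subseteq> B"
    and "B \<subseteq> {x. \<forall>i. -1 \<le> x $ i \<and> x $ i \<le> 1}"
    and "B \<in> sets borel"
    and "\<And>j x. x \<in> semialg_set g \<Longrightarrow> 0 \<le> poly_eval (g j) x \<and> poly_eval (g j) x \<le> 1"
    and "subalgebra hull (insert 1 (range g)) = UNIV"
  shows "(\<forall>d. \<exists>y. lp_optimal g B d y) \<and>
         decseq (lp_value g B) \<and>
         lp_value g B \<longlonglongrightarrow> measure lborel (semialg_set g) / 2 ^ CARD('n) \<and>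
         (\<forall>y. (\<forall>d. lp_optimal g B d (y d)) \<longrightarrow>
            (\<forall>\<alpha>. (\<lambda>d. y d \<alpha>) \<longlonglongrightarrow>
               (LINT x:semialg_set g|normalized_lebesgue B. mpower (\<lambda>i. x $ i) \<alpha>)))"
proof -
  have box: "B \<subseteq> symmetric_cube" using assms(3) by (simp add: symmetric_cube_def)
  note setting = assms(4) box
  obtain X where X: "\<And>i. subst g (X i) = Var i"
    using generating_imp_variables[OF assms(6)] by blast
  have deg: "max_degree g \<ge> 1" by (rule max_degree_pos[of g X, OF X])
  have K: "semialg_set g \<in> sets (normalized_lebesgue B)"
    using assms(1,2,4) by (simp add: sets_normalized_lebesgue borel_compact)
  have "\<exists>y. lp_optimal g B d y" for d
    using restricted_moments_feasible[OF setting deg K assms(5), of d]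
    by (intro lp_optimal_exists deg) auto
  then obtain y where y: "\<And>d. lp_optimal g B d (y d)" by metis
  have val: "lp_value g B = (\<lambda>d. y d 0)"
    by (rule ext) (rule lp_value_optimal[OF y])
  have "decseq (lp_value g B)"
  proof (rule decseq_SucI)
    fix d
    have "restrict (y (Suc d)) (lp_index g d) \<in> lp_feasible g B d"
      using y[of "Suc d"] by (intro lp_feasible_mono[OF deg, of d "Suc d"]) (auto simp: lp_optimal_def)
    then have "restrict (y (Suc d)) (lp_index g d) 0 \<le> y d 0"
      using y[of d] unfolding lp_optimal_def by blast
    then show "lp_value g B (Suc d) \<le> lp_value g B d" by (simp add: val zero_in_lp_index)
  qed
  moreover have "lp_value g B \<longlonglongrightarrow> measure lborel (semialg_set g) / 2 ^ CARD('n)"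
  proof -
    interpret finite_measure "normalized_lebesgue B"
      by (rule finite_measure_normalized_lebesgue[OF setting])
    have "moments_on B (semialg_set g) 0 = measure lborel (semialg_set g) / 2 ^ CARD('n)"
      using K assms(2) by (simp add: moments_on_def set_lebesgue_integral_def
          measure_normalized_lebesgue[OF assms(4)] Int_absorb1 Int_absorb2)
    then show ?thesis
      using optimal_moments_tendsto[of B g X y 0, OF setting X K assms(5) y] by (simp add: val)
  qed
  moreover have "(\<lambda>d. z d \<alpha>) \<longlonglongrightarrow>
      (LINT x:semialg_set g|normalized_lebesgue B. mpower (\<lambda>i. x $ i) \<alpha>)"
    if "\<forall>d. lp_optimal g B d (z d)" for z \<alpha>
    using optimal_moments_tendsto[of B g X z \<alpha>, OF setting X K assms(5)] that
    by (simp add: moments_on_def)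
  ultimately show ?thesis using y by blast
qed

end
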